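(* Let $V^{\mathbf{P}}(\epsilon)$ denote the optimal value of the singularly perturbed primal problem $\mathbf{P}$ and $V^{\mathbf{D}}(\epsilon)$ the optimal value of the dual problem $\mathbf{D}$ (both problems, and the standing assumptions on their data, are defined in the context). Then $$V^{\mathbf{P}}(\epsilon) = V^{\mathbf{D}}(\epsilon) \quad \text{for all } \epsilon \in (0,\epsilon^*].$$
   Context: **Notation.** Fix $m,n,k\ge 1$, $\epsilon^*>0$, $z_{1,0}\in\mathbb{R}^m$, $z_{2,0}\in\mathbb{R}^n$, $z_0^T=[z_{1,0}^T,z_{2,0}^T]$. For $\epsilon>0$ put $I^\epsilon=\begin{bmatrix} I_m & 0 \\ 0 & \epsilon I_n \end{bmatrix}$. $W^{1,2}$ denotes the Sobolev space of (absolutely continuous) functions on $[0,1]$. The data are real matrices $A(t,\epsilon)=\begin{bmatrix} A_{11} & A_{12} \\ A_{21} & A_{22} \end{bmatrix}$ ($A_{11}\in\mathbb{R}^{m\times m}$, $A_{22}\in\mathbb{R}^{n\times n}$), $b(t,\epsilon)=\begin{bmatrix} b_1 \\ b_2 \end{bmatrix}$ ($b_1\in\mathbb{R}^{m\times k}$, $b_2\in\mathbb{R}^{n\times k}$), $Q(t,\epsilon)\in\mathbb{R}^{(m+n)\times(m+n)}$, $R(t,\epsilon)\in\mathbb{R}^{k\times k}$, $\pi(\epsilon)=\begin{bmatrix} \pi_{11}(\epsilon) & 0 \\ 0 & \epsilon\pi_{22}(\epsilon) \end{bmatrix}$ ($\pi_{11}\in\mathbb{R}^{m\times m}$, $\pi_{22}\in\mathbb{R}^{n\times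 n}$). **Control set.** $U=\{u\in L^2([0,1];\mathbb{R}^k):\alpha_j(t)\le u_j(t)\le\beta_j(t),\ j=1,\dots,k,\ t\in[0,1]\}$, with $\alpha,\beta$ smooth on $[0,1]$. **Primal problem $\mathbf{P}$.** For $\epsilon\in(0,\epsilon^*]$, minimise over $\hat u\in U$ $$J^{\mathbf{P}}=\tfrac12\int_0^1\big(\hat z^TQ\hat z+\hat u^TR\hat u\big)\,dt+\tfrac12\hat z(1,\epsilon)^T\pi(\epsilon)\hat z(1,\epsilon),$$ where $\hat z^T=[\hat z_1^T,\hat z_2^T]$, $\hat z\in W^{1,2}([0,1];\mathbb{R}^{m+n})$ satisfies $I^\epsilon\frac{d\hat z}{dt}=A(t,\epsilon)\hat z+I^\epsilon b(t,\epsilon)\hat u$, $\hat z(0,\epsilon)=z_0$. $V^{\mathbf{P}}(\epsilon)$ is the value of $J^{\mathbf{P}}$ at the optimal control. **Dual problem $\mathbf{D}$.** For $\epsilon\in(0,\epsilon^*]$, maximise over $\hat\gamma,\hat\rho\in W^{1,2}([0,1];\mathbb{R}^{m+n})$ (with no prescribed boundary values) subject to $I^\epsilon\frac{d\hat\gamma}{dt}=-A(t,\epsilon)^T\hat\gamma+\hat\rho$ the functional $$J^{\mathbf{D}}=\int_0^1\Big(-\tfrac12\hat\rho^TQ^{-1}\hat\rho-\theta(\hat\gamma)\Big)dt-\hat\gamma(0,\epsilon)^TI^\epsilon z_0-\tfrac12\hat\gamma(1,\epsilon)^TI^\epsilon\pi(\epsilon)^{-1}I^\epsilon\hat\gamma(1,\epsilon),$$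 where $\theta(\hat\gamma)=\sum_{j=1}^k\theta_j(\hat\gamma)$ and $$\theta_j(\hat\gamma)=\begin{cases}\frac{1}{2R_{jj}}(\hat\gamma^TI^\epsilon b)_j^2&\text{if }\alpha_j\le(R^{-1}b^TI^\epsilon\hat\gamma)_j\le\beta_j,\\ \alpha_j(\hat\gamma^TI^\epsilon b)_j-\frac12\alpha_j^2R_{jj}&\text{if }\alpha_j>(R^{-1}b^TI^\epsilon\hat\gamma)_j,\\ \beta_j(\hat\gamma^TI^\epsilon b)_j-\frac12\beta_j^2R_{jj}&\text{if }\beta_j<(R^{-1}b^TI^\epsilon\hat\gamma)_j.\end{cases}$$ $V^{\mathbf{D}}(\epsilon)$ is the value of $J^{\mathbf{D}}$ at the optimum. **Standing assumptions.** $R$ is diagonal and positive definite; $Q$ and $\pi$ are symmetric and positive definite (for $\epsilon\in(0,\epsilon^*]$); $A_{22}(t,\epsilon)$ is negative definite for all $t\in[0,1]$, $\epsilon\in[0,\epsilon^*]$; for each fixed $\epsilon\in[0,\epsilon^*]$ the matrices $Q,R,A_{ij},b_i$ are smooth in $t\in[0,1]$; $Q,R,\pi,A_{ij},b_i$ have convergent power series expansions in $\epsilon$ valid over their domains; the feasible set of $\mathbf{P}$ is nonempty (so $\mathbf{P}$ has a unique solution). *)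

theory Defs
  imports "HOL-Analysis.Analysis"
begin

section \<open>Block vectors and matrices\<close>

text \<open>
  The state space is indexed by the disjoint sum \<^typ>\<open>'m + 'n\<close>: slow components \<^const>\<open>Inl\<close>,
  fast components \<^const>\<open>Inr\<close>. Matrices are vectors of rows, so stacking the rows of
  two matrices is the same operation as concatenating two vectors.
\<close>

definition stack :: "'a^'m \<Rightarrow> 'a^'n \<Rightarrow> 'a^('m::finite + 'n::finite)" where
  "stack x y = (\<chi> i. case i of Inl a \<Rightarrow> x $ a | Inr b \<Rightarrow> y $ b)"

definition block_mat ::
  "'a^'m^'m \<Rightarrow> 'a^'n^'m \<Rightarrow> 'a^'m^'n \<Rightarrow> 'a^'n^'n \<Rightarrow> 'a^('m::finite + 'n::finite)^('m + 'n)" where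
  "block_mat A B C D = stack (\<chi> i. stack (A $ i) (B $ i)) (\<chi> i. stack (C $ i) (D $ i))"

definition I_eps :: "real \<Rightarrow> real^('m::finite + 'n::finite)^('m + 'n)" where
  "I_eps \<epsilon> = block_mat (mat 1) 0 0 (mat \<epsilon>)"

text \<open>Definiteness does not include symmetry; symmetry is assumed separately where needed.\<close>

definition pos_def :: "real^'n^'n \<Rightarrow> bool" where
  "pos_def M \<longleftrightarrow> (\<forall>x. x \<noteq> 0 \<longrightarrow> x \<bullet> (M *v x) > 0)"

definition neg_def :: "real^'n^'n \<Rightarrow> bool" where
  "neg_def M \<longleftrightarrow> (\<forall>x. x \<noteq> 0 \<longrightarrow> x \<bullet> (M *v x) < 0)"

definition diagonal :: "real^'n^'n \<Rightarrow> bool" where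
  "diagonal M \<longleftrightarrow> (\<forall>i j. i \<noteq> j \<longrightarrow> M $ i $ j = 0)"


section \<open>Regularity on the unit interval\<close>

text \<open>Infinitely often differentiable on [0,1], one-sidedly at the end points:
  \<^term>\<open>F i\<close> is the derivative of order \<^term>\<open>i\<close>.\<close>

definition smooth01 :: "(real \<Rightarrow> 'a::real_normed_vector) \<Rightarrow> bool" where
  "smooth01 f \<longleftrightarrow> (\<exists>F :: nat \<Rightarrow> real \<Rightarrow> 'a. F 0 = f \<and>
     (\<forall>i. \<forall>t\<in>{0..1}. (F i has_vector_derivative F (Suc i) t) (at t within {0..1})))"

definition has_power_series_on :: "real set \<Rightarrow> (real \<Rightarrow> 'a::real_normed_vector) \<Rightarrow> bool" where
  "has_power_series_on S f \<longleftrightarrow> (\<exists>c :: nat \<Rightarrow> 'a. \<forall>\<epsilon>\<in>S. (\<lambda>i. \<epsilon> ^ i *\<^sub>R c i) sums f \<epsilon>)"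

abbreviation leb01 :: "real measure" where
  "leb01 \<equiv> lebesgue_on {0..1}"

definition L2 :: "(real \<Rightarrow> 'a::euclidean_space) set" where
  "L2 = {f. f \<in> borel_measurable leb01 \<and> integrable leb01 (\<lambda>t. (norm (f t))\<^sup>2)}"

text \<open>A finite family of non-overlapping closed subintervals of [0,1] is a division of
  its union; \<^term>\<open>Inf k\<close> and \<^term>\<open>Sup k\<close> are the end points of an interval \<^term>\<open>k\<close>.\<close>

definition abs_cont01 :: "(real \<Rightarrow> 'a::real_normed_vector) \<Rightarrow> bool" where
  "abs_cont01 f \<longleftrightarrow> (\<forall>e>0. \<exists>\<delta>>0. \<forall>d T. d division_of T \<longrightarrow> T \<subseteq> {0..1} \<longrightarrow>
     (\<Sum>k\<in>d. Sup k - Inf k) < \<delta> \<longrightarrow> (\<Sum>k\<in>d. norm (f (Sup k) - f (Inf k))) < e)"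

definition ddt :: "(real \<Rightarrow> 'a::real_normed_vector) \<Rightarrow> real \<Rightarrow> 'a" where
  "ddt f t = vector_derivative f (at t within {0..1})"

text \<open>Elements are the absolutely continuous representatives.\<close>

definition W12 :: "(real \<Rightarrow> 'a::euclidean_space) set" where
  "W12 = {f. abs_cont01 f \<and> (AE t in leb01. f differentiable (at t within {0..1})) \<and> ddt f \<in> L2}"


section \<open>The problem data\<close>

record ('m, 'n, 'k) lq_data =
  A11 :: "real \<Rightarrow> real \<Rightarrow> real^'m^'m::finite"
  A12 :: "real \<Rightarrow> real \<Rightarrow> real^'n^'m::finite"
  A21 :: "real \<Rightarrow> real \<Rightarrow> real^'m^'n::finite"
  A22 :: "real \<Rightarrow> real \<Rightarrow> real^'n^'n::finite"
  b1 :: "real \<Rightarrow> real \<Rightarrow> real^'k^'m::finite"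
  b2 :: "real \<Rightarrow> real \<Rightarrow> real^'k^'n::finite"
  Qmat :: "real \<Rightarrow> real \<Rightarrow> real^('m::finite + 'n::finite)^('m + 'n)"
  Rmat :: "real \<Rightarrow> real \<Rightarrow> real^'k^'k::finite"
  pi11 :: "real \<Rightarrow> real^'m^'m::finite"
  pi22 :: "real \<Rightarrow> real^'n^'n::finite"
  alpha :: "real \<Rightarrow> real^'k::finite"
  beta :: "real \<Rightarrow> real^'k::finite"
  z10 :: "real^'m::finite"
  z20 :: "real^'n::finite"

text \<open>In all functions of two real arguments the first is \<open>t\<close> and the second is \<open>\<epsilon>\<close>.\<close>

definition Amat :: "('m::finite, 'n::finite, 'k::finite) lq_data \<Rightarrow> real \<Rightarrow> real \<Rightarrow>
    real^('m + 'n)^('m + 'n)" where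
  "Amat S t \<epsilon> = block_mat (A11 S t \<epsilon>) (A12 S t \<epsilon>) (A21 S t \<epsilon>) (A22 S t \<epsilon>)"

definition bmat :: "('m::finite, 'n::finite, 'k::finite) lq_data \<Rightarrow> real \<Rightarrow> real \<Rightarrow>
    real^'k^('m + 'n)" where
  "bmat S t \<epsilon> = stack (b1 S t \<epsilon>) (b2 S t \<epsilon>)"

definition pimat :: "('m::finite, 'n::finite, 'k::finite) lq_data \<Rightarrow> real \<Rightarrow>
    real^('m + 'n)^('m + 'n)" where
  "pimat S \<epsilon> = block_mat (pi11 S \<epsilon>) 0 0 (\<epsilon> *\<^sub>R pi22 S \<epsilon>)"

definition z0 :: "('m::finite, 'n::finite, 'k::finite) lq_data \<Rightarrow> real^('m + 'n)" where
  "z0 S = stack (z10 S) (z20 S)"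


section \<open>The primal problem\<close>

definition controls :: "('m::finite, 'n::finite, 'k::finite) lq_data \<Rightarrow> (real \<Rightarrow> real^'k) set" where
  "controls S = {u \<in> L2. AE t in leb01. \<forall>j. alpha S t $ j \<le> u t $ j \<and> u t $ j \<le> beta S t $ j}"

definition primal_feasible :: "('m::finite, 'n::finite, 'k::finite) lq_data \<Rightarrow> real \<Rightarrow>
    (real \<Rightarrow> real^'k) \<Rightarrow> (real \<Rightarrow> real^('m + 'n)) \<Rightarrow> bool" where
  "primal_feasible S \<epsilon> u z \<longleftrightarrow> u \<in> controls S \<and> z \<in> W12 \<and>
     (AE t in leb01. I_eps \<epsilon> *v ddt z t = Amat S t \<epsilon> *v z t + (I_eps \<epsilon> ** bmat S t \<epsilon>) *v u t) \<and>
     z 0 = z0 S"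

definition J_primal :: "('m::finite, 'n::finite, 'k::finite) lq_data \<Rightarrow> real \<Rightarrow>
    (real \<Rightarrow> real^'k) \<Rightarrow> (real \<Rightarrow> real^('m + 'n)) \<Rightarrow> real" where
  "J_primal S \<epsilon> u z =
     1/2 * (\<integral>t. (z t \<bullet> (Qmat S t \<epsilon> *v z t) + u t \<bullet> (Rmat S t \<epsilon> *v u t)) \<partial>leb01) +
     1/2 * (z 1 \<bullet> (pimat S \<epsilon> *v z 1))"

definition primal_optimal :: "('m::finite, 'n::finite, 'k::finite) lq_data \<Rightarrow> real \<Rightarrow>
    (real \<Rightarrow> real^'k) \<Rightarrow> (real \<Rightarrow> real^('m + 'n)) \<Rightarrow> bool" where
  "primal_optimal S \<epsilon> u z \<longleftrightarrow> primal_feasible S \<epsilon> u z \<and>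
     (\<forall>u' z'. primal_feasible S \<epsilon> u' z' \<longrightarrow> J_primal S \<epsilon> u z \<le> J_primal S \<epsilon> u' z')"

definition V_primal :: "('m::finite, 'n::finite, 'k::finite) lq_data \<Rightarrow> real \<Rightarrow> real" where
  "V_primal S \<epsilon> = (THE v. \<exists>u z. primal_optimal S \<epsilon> u z \<and> v = J_primal S \<epsilon> u z)"


section \<open>The dual problem\<close>

definition theta_j :: "('m::finite, 'n::finite, 'k::finite) lq_data \<Rightarrow> real \<Rightarrow> real \<Rightarrow>
    real^('m + 'n) \<Rightarrow> 'k \<Rightarrow> real" where
  "theta_j S t \<epsilon> g j =
    (let s = ((g v* I_eps \<epsilon>) v* bmat S t \<epsilon>) $ j;
         w = ((matrix_inv (Rmat S t \<epsilon>) ** transpose (bmat S t \<epsilon>) ** I_eps \<epsilon>) *v g) $ j;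
         r = Rmat S t \<epsilon> $ j $ j;
         a = alpha S t $ j;
         b = beta S t $ j
     in if a \<le> w \<and> w \<le> b then 1 / (2 * r) * s\<^sup>2
        else if a > w then a * s - 1/2 * a\<^sup>2 * r
        else b * s - 1/2 * b\<^sup>2 * r)"

definition theta :: "('m::finite, 'n::finite, 'k::finite) lq_data \<Rightarrow> real \<Rightarrow> real \<Rightarrow>
    real^('m + 'n) \<Rightarrow> real" where
  "theta S t \<epsilon> g = (\<Sum>j\<in>UNIV. theta_j S t \<epsilon> g j)"

definition dual_feasible :: "('m::finite, 'n::finite, 'k::finite) lq_data \<Rightarrow> real \<Rightarrow>
    (real \<Rightarrow> real^('m + 'n)) \<Rightarrow> (real \<Rightarrow> real^('m + 'n)) \<Rightarrow> bool" where
  "dual_feasible S \<epsilon> \<gamma> \<rho> \<longleftrightarrow> \<gamma> \<in> W12 \<and> \<rho> \<in> W12 \<and>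
     (AE t in leb01. I_eps \<epsilon> *v ddt \<gamma> t = - (transpose (Amat S t \<epsilon>) *v \<gamma> t) + \<rho> t)"

definition J_dual :: "('m::finite, 'n::finite, 'k::finite) lq_data \<Rightarrow> real \<Rightarrow>
    (real \<Rightarrow> real^('m + 'n)) \<Rightarrow> (real \<Rightarrow> real^('m + 'n)) \<Rightarrow> real" where
  "J_dual S \<epsilon> \<gamma> \<rho> =
     (\<integral>t. (- 1/2 * (\<rho> t \<bullet> (matrix_inv (Qmat S t \<epsilon>) *v \<rho> t)) - theta S t \<epsilon> (\<gamma> t)) \<partial>leb01)
     - \<gamma> 0 \<bullet> (I_eps \<epsilon> *v z0 S)
     - 1/2 * (\<gamma> 1 \<bullet> ((I_eps \<epsilon> ** matrix_inv (pimat S \<epsilon>) ** I_eps \<epsilon>) *v \<gamma> 1))"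

definition dual_optimal :: "('m::finite, 'n::finite, 'k::finite) lq_data \<Rightarrow> real \<Rightarrow>
    (real \<Rightarrow> real^('m + 'n)) \<Rightarrow> (real \<Rightarrow> real^('m + 'n)) \<Rightarrow> bool" where
  "dual_optimal S \<epsilon> \<gamma> \<rho> \<longleftrightarrow> dual_feasible S \<epsilon> \<gamma> \<rho> \<and>
     (\<forall>\<gamma>' \<rho>'. dual_feasible S \<epsilon> \<gamma>' \<rho>' \<longrightarrow> J_dual S \<epsilon> \<gamma>' \<rho>' \<le> J_dual S \<epsilon> \<gamma> \<rho>)"

definition V_dual :: "('m::finite, 'n::finite, 'k::finite) lq_data \<Rightarrow> real \<Rightarrow> real" where
  "V_dual S \<epsilon> = (THE v. \<exists>\<gamma> \<rho>. dual_optimal S \<epsilon> \<gamma> \<rho> \<and> v = J_dual S \<epsilon> \<gamma> \<rho>)"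

end

theory Submission
  imports Defs
begin

text \<open>
  Write \<open>p = I \<gamma>\<close> for a dual trajectory. Integrating \<open>(z \<bullet> p)'\<close> turns the difference of the primal
  and dual functionals into a sum of three Fenchel-Young defects, for the state cost, the constrained
  control cost and the terminal cost; each is nonnegative, which is weak duality. All three vanish
  when \<open>\<rho> = Q z\<close>, \<open>u\<close> is \<open>R\<inverse> b\<^sup>T p\<close> clipped to the control box, and \<open>p(1) = - \<pi> z(1)\<close>, so it
  suffices to solve this extremal two-point boundary value problem. The clipped control is bounded, and
  therefore a shooting map differs from the identity by a bounded continuous map; Brouwer's theorem
  gives a solution.
\<close>

section \<open>Ordinary differential equations on the unit interval\<close>

text \<open>A two-point problem for a globally Lipschitz system need not be solvable; linear ones
  already fail at conjugate points. What helps here is one-sided: the adjoint \<open>p\<close> may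
  depend on \<open>z\<close> without bound, but it acts back on \<open>z\<close> only through the
  control. Prescribing \<open>z 1\<close> also fixes \<open>p 1\<close>, so the coupled system is
  run from the right end as an ordinary terminal value problem, and only \<open>z 0\<close> remains
  to be matched. No minimising sequence or weak compactness enters: a solution of the two-point
  problem yields a primal and a dual point with equal objectives, and weak duality certifies both as
  optimal. The parameter \<epsilon> is fixed and positive, so \<open>I_eps \<epsilon>\<close> can be
  inverted and the equations become ordinary ones in \<open>z\<close> and \<open>p\<close>. The
  extremal is continuously differentiable, but weak duality has to face arbitrary controls in
  \<open>L2\<close>, whose states are differentiable only almost everywhere. This is why the
  fundamental theorem of calculus is developed for absolutely continuous functions.\<close>

lemma picard_lindelof_unit_interval:
  fixes f :: "real \<Rightarrow> 'a::banach \<Rightarrow> 'a"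
  assumes cont: "continuous_on ({0..1} \<times> UNIV) (\<lambda>(t, x). f t x)"
    and lip: "\<And>t x y. t \<in> {0..1} \<Longrightarrow> norm (f t x - f t y) \<le> L * norm (x - y)"
  obtains x where "x 0 = a"
    "\<And>t. t \<in> {0..1} \<Longrightarrow> (x has_vector_derivative f t (x t)) (at t within {0..1})"
proof -
  \<comment> \<open>The unknown is \<open>exp (- K * t) *\<^sub>R x t\<close> instead of
    \<open>x t\<close>. With this exponential weight the integral operator has Lipschitz constant at
    most \<open>\<bar>L\<bar> / K\<close>; the factor 2 makes it at most 1/2 on the whole interval,
    so short-time solutions need not be glued, and the added 1 keeps \<open>K\<close>
    positive.\<close>
  define K where "K = 2 * (\<bar>L\<bar> + 1)"
  have K: "K > 0" "\<bar>L\<bar> / K \<le> 1 / 2"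
    unfolding K_def by (auto simp: field_simps)
  define G :: "(real \<Rightarrow>\<^sub>C 'a) \<Rightarrow> real \<Rightarrow> 'a" where "G y s = f s (exp (K * s) *\<^sub>R y s)" for y s
  define H where "H y t = exp (- K * t) *\<^sub>R (a + integral {0..t} (G y))" for y t
  have contG: "continuous_on {0..1} (G y)" for y
  proof -
    have "continuous_on {0..1} (\<lambda>s. (\<lambda>(t, x). f t x) (s, exp (K * s) *\<^sub>R y s))"
      by (rule continuous_on_compose2[OF cont]) (auto intro!: continuous_intros)
    then show ?thesis by (simp add: G_def)
  qed
  have contH: "continuous_on {0..1} (H y)" for y
    unfolding H_def
    by (intro continuous_intros indefinite_integral_continuous_1 integrable_continuous_interval contG)
  \<comment> \<open>Bounded continuous functions on the real line form a complete space. Composition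
    with \<open>clamp 0 1\<close> extends \<open>H y\<close> constantly outside [0,1], so that the
    operator acts on that space.\<close>
  define T :: "(real \<Rightarrow>\<^sub>C 'a) \<Rightarrow> (real \<Rightarrow>\<^sub>C 'a)"
    where "T y = (SOME g :: real \<Rightarrow>\<^sub>C 'a. \<forall>t. g t = H y (clamp 0 1 t))" for y
  have T: "T y t = H y (clamp 0 1 t)" for y t
  proof -
    obtain g :: "real \<Rightarrow>\<^sub>C 'a" where "\<And>t. g t = H y (clamp 0 1 t)"
      using continuous_on_cbox_bcontfunE[of 0 1 "H y"] contH by auto
    then have "\<forall>t. T y t = H y (clamp 0 1 t)"
      unfolding T_def by (intro someI[of "\<lambda>g. \<forall>t. apply_bcontfun g t = H y (clamp 0 1 t)" g]) auto
    then show ?thesis by blast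
  qed
  have clamp01: "clamp 0 1 t \<in> {0..1}" for t :: real
    using clamp_in_interval[of 0 1 t] by simp
  have HH: "dist (H y t) (H z t) \<le> 1/2 * dist y z" if t: "t \<in> {0..1}" for y z t
  proof -
    have intG: "G w integrable_on {0..t}" for w
      using integrable_continuous_interval[OF continuous_on_subset[OF contG]] t by auto
    have "((\<lambda>s. \<bar>L\<bar> * dist y z * exp (K * s)) has_integral
        \<bar>L\<bar> * dist y z / K * exp (K * t) - \<bar>L\<bar> * dist y z / K * exp (K * 0)) {0..t}"
      using t K(1) by (intro fundamental_theorem_of_calculus)
        (auto intro!: derivative_eq_intros simp flip: has_real_derivative_iff_has_vector_derivative)
    then have I: "((\<lambda>s. \<bar>L\<bar> * dist y z * exp (K * s)) has_integral
        \<bar>L\<bar> * dist y z / K * (exp (K * t) - 1)) {0..t}"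
      by (simp add: algebra_simps diff_divide_distrib)
    have "dist (H y t) (H z t) = exp (- K * t) * norm (integral {0..t} (\<lambda>s. G y s - G z s))"
      unfolding H_def dist_norm
      by (simp add: integral_diff[OF intG intG] flip: scaleR_diff_right)
    also have "\<dots> \<le> exp (- K * t) * (\<bar>L\<bar> * dist y z / K * (exp (K * t) - 1))"
    proof (rule mult_left_mono)
      have "norm (integral {0..t} (\<lambda>s. G y s - G z s))
          \<le> integral {0..t} (\<lambda>s. \<bar>L\<bar> * dist y z * exp (K * s))"
      proof (rule integral_norm_bound_integral)
        fix s assume s: "s \<in> {0..t}"
        have "norm (G y s - G z s) \<le> L * norm (exp (K * s) *\<^sub>R y s - exp (K * s) *\<^sub>R z s)"
          unfolding G_def using s t by (intro lip) auto
        also have "\<dots> \<le> \<bar>L\<bar> * norm (exp (K * s) *\<^sub>R y s - exp (K * s) *\<^sub>R z s)"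
          by (intro mult_right_mono) auto
        also have "\<dots> = \<bar>L\<bar> * dist (y s) (z s) * exp (K * s)"
          by (simp add: dist_norm flip: scaleR_diff_right)
        also have "\<dots> \<le> \<bar>L\<bar> * dist y z * exp (K * s)"
          by (intro mult_right_mono mult_left_mono dist_bounded) auto
        finally show "norm (G y s - G z s) \<le> \<bar>L\<bar> * dist y z * exp (K * s)" .
      qed (use I intG in \<open>auto intro: integrable_diff\<close>)
      then show "norm (integral {0..t} (\<lambda>s. G y s - G z s)) \<le> \<bar>L\<bar> * dist y z / K * (exp (K * t) - 1)"
        using integral_unique[OF I] by simp
    qed simp
    also have "\<dots> = \<bar>L\<bar> / K * dist y z * (1 - exp (- K * t))"
      by (simp add: algebra_simps exp_minus)
    also have "\<dots> \<le> \<bar>L\<bar> / K * dist y z * 1"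
      using K by (intro mult_left_mono) auto
    also have "\<dots> \<le> 1/2 * dist y z"
      using K(2) by (simp only: mult_1_right) (intro mult_right_mono, auto)
    finally show ?thesis .
  qed
  have "\<exists>!y. T y = y"
  proof (rule banach_fix_type[of "1/2"], simp_all only: simp_thms, intro allI)
    show "dist (T y) (T z) \<le> 1/2 * dist y z" for y z
      by (rule dist_bound) (simp only: T HH[OF clamp01])
  qed
  then obtain y where y: "T y = y" by blast
  have yH: "y t = H y t" if "t \<in> {0..1}" for t
    using T[of y t] that by (simp add: y)
  define x where "x t = a + integral {0..t} (G y)" for t
  have xy: "exp (K * t) *\<^sub>R y t = x t" if "t \<in> {0..1}" for t
    using yH[OF that] by (simp add: H_def x_def flip: exp_add)
  show ?thesis
  proof
    show "x 0 = a" by (simp add: x_def)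
    fix t :: real assume t: "t \<in> {0..1}"
    have "(x has_vector_derivative G y t) (at t within {0..1})"
      unfolding x_def using integral_has_vector_derivative[OF contG t]
      by (auto intro!: derivative_eq_intros)
    then show "(x has_vector_derivative f t (x t)) (at t within {0..1})"
      using xy[OF t] by (simp add: G_def)
  qed
qed

text \<open>Time reversal carries both the existence theorem and the growth bound from the left end
  point to the right one.\<close>

lemma has_vector_derivative_reverse_unit_interval:
  fixes y :: "real \<Rightarrow> 'a::real_normed_vector"
  assumes "\<And>t. t \<in> {0..1} \<Longrightarrow> (y has_vector_derivative y' t) (at t within {0..1})"
    and t: "t \<in> {0..1}"
  shows "((\<lambda>t. y (1 - t)) has_vector_derivative - y' (1 - t)) (at t within {0..1})"
proof -
  have im: "(\<lambda>t::real. 1 - t) ` {0..1} = {0..1}"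
    by (auto simp: image_def intro!: bexI[of _ "1 - _"])
  have "((\<lambda>t::real. 1 - t) has_vector_derivative -1) (at t within {0..1})"
    by (auto intro!: derivative_eq_intros)
  from vector_diff_chain_within[OF this, of y "y' (1 - t)"] assms
  show ?thesis by (simp add: im o_def)
qed

lemma picard_lindelof_unit_interval_backward:
  fixes f :: "real \<Rightarrow> 'a::banach \<Rightarrow> 'a"
  assumes cont: "continuous_on ({0..1} \<times> UNIV) (\<lambda>(t, x). f t x)"
    and lip: "\<And>t x y. t \<in> {0..1} \<Longrightarrow> norm (f t x - f t y) \<le> L * norm (x - y)"
  obtains x where "x 1 = a"
    "\<And>t. t \<in> {0..1} \<Longrightarrow> (x has_vector_derivative f t (x t)) (at t within {0..1})"
proof -
  have c: "continuous_on ({0..1} \<times> UNIV) (\<lambda>p. (\<lambda>(t, x). f t x) (1 - fst p, snd p))"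
    by (rule continuous_on_compose2[OF cont]) (auto intro!: continuous_intros)
  obtain x where x: "x 0 = a"
    "\<And>t. t \<in> {0..1} \<Longrightarrow> (x has_vector_derivative - f (1 - t) (x t)) (at t within {0..1})"
  proof (rule picard_lindelof_unit_interval[of "\<lambda>t x. - f (1 - t) x" L a])
    show "continuous_on ({0..1} \<times> UNIV) (\<lambda>(t, x). - f (1 - t) x)"
      using continuous_on_minus[OF c] by (simp add: case_prod_beta)
    show "norm (- f (1 - t) x - - f (1 - t) y) \<le> L * norm (x - y)" if "t \<in> {0..1}" for t x y
      using lip[of "1 - t" x y] that by (simp add: norm_minus_commute)
  qed blast
  show ?thesis
  proof (rule that[of "\<lambda>t. x (1 - t)"])
    show "((\<lambda>t. x (1 - t)) has_vector_derivative f t (x (1 - t))) (at t within {0..1})"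
      if "t \<in> {0..1}" for t
      using has_vector_derivative_reverse_unit_interval[OF x(2) that] by simp
  qed (simp add: x)
qed

text \<open>A Gronwall estimate. The norm is not differentiable at zero, so the argument runs with
  its square: by Young's inequality \<open>y s \<bullet> y s + C\<^sup>2\<close> grows at rate at
  most \<open>k = 2 * (L + 1)\<close>. Taking the root halves the rate, which gives
  \<open>exp (L + 1)\<close>.\<close>

lemma norm_growth_bound:
  fixes y :: "real \<Rightarrow> 'a::real_inner"
  assumes der: "\<And>t. t \<in> {0..1} \<Longrightarrow> (y has_vector_derivative y' t) (at t within {0..1})"
    and bound: "\<And>t. t \<in> {0..1} \<Longrightarrow> norm (y' t) \<le> L * norm (y t) + C"
    and L: "L \<ge> 0" and C: "C \<ge> 0" and t: "t \<in> {0..1}"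
  shows "norm (y t) \<le> (norm (y 0) + C) * exp (L + 1)"
proof -
  define k where "k = 2 * (L + 1)"
  define h where "h s = (y s \<bullet> y s + C\<^sup>2) * exp (- k * s)" for s
  have h': "(h has_real_derivative (2 * (y s \<bullet> y' s) - k * (y s \<bullet> y s + C\<^sup>2)) * exp (- k * s))
      (at s within {0..1})" if s: "s \<in> {0..1}" for s
  proof -
    have "((\<lambda>s. y s \<bullet> y s) has_real_derivative 2 * (y s \<bullet> y' s)) (at s within {0..1})"
      using has_derivative_inner[OF der[OF s, unfolded has_vector_derivative_def]
          der[OF s, unfolded has_vector_derivative_def]]
      by (simp add: has_field_derivative_def inner_commute mult_commute_abs algebra_simps)
    then show ?thesis
      unfolding h_def by (auto intro!: derivative_eq_intros simp: algebra_simps)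
  qed
  have neg: "(2 * (y s \<bullet> y' s) - k * (y s \<bullet> y s + C\<^sup>2)) * exp (- k * s) \<le> 0" if s: "s \<in> {0..1}" for s
  proof (rule mult_nonpos_nonneg)
    have "y s \<bullet> y' s \<le> norm (y s) * (L * norm (y s) + C)"
      using Cauchy_Schwarz_ineq2[of "y s" "y' s"] mult_left_mono[OF bound[OF s], of "norm (y s)"]
      by (simp add: abs_le_iff)
    moreover have "2 * norm (y s) * C \<le> (norm (y s))\<^sup>2 + C\<^sup>2"
      by (rule sum_squares_bound)
    ultimately have "2 * (y s \<bullet> y' s) \<le> 2 * L * (norm (y s))\<^sup>2 + (norm (y s))\<^sup>2 + C\<^sup>2"
      by (simp add: algebra_simps power2_eq_square)
    moreover have "k * (y s \<bullet> y s + C\<^sup>2) = 2 * L * (norm (y s))\<^sup>2 + 2 * (norm (y s))\<^sup>2 + 2 * L * C\<^sup>2 + 2 * C\<^sup>2"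
      by (simp add: k_def power2_norm_eq_inner algebra_simps)
    moreover have "0 \<le> L * C\<^sup>2" using L by simp
    ultimately show "2 * (y s \<bullet> y' s) - k * (y s \<bullet> y s + C\<^sup>2) \<le> 0"
      using zero_le_power2[of "norm (y s)"] zero_le_power2[of C] by linarith
  qed simp
  have "h t \<le> h 0"
  proof (rule DERIV_nonpos_imp_decreasing_open[where f = h and a = 0 and b = t])
    show "continuous_on {0..t} h"
      using DERIV_continuous_on[of "{0..1}" h, OF h'] by (rule continuous_on_subset) (use t in auto)
    show "\<exists>d. (h has_real_derivative d) (at s) \<and> d \<le> 0" if s: "0 < s" "s < t" for s
      using h'[of s] neg[of s] t s at_within_Icc_at[of 0 s 1] by auto
  qed (use t in auto)
  then have "(y t \<bullet> y t + C\<^sup>2) * exp (- k * t) \<le> y 0 \<bullet> y 0 + C\<^sup>2" by (simp add: h_def)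
  then have "(y t \<bullet> y t + C\<^sup>2) \<le> (y 0 \<bullet> y 0 + C\<^sup>2) * exp (k * t)"
    by (simp add: exp_minus field_simps)
  also have "\<dots> \<le> (y 0 \<bullet> y 0 + C\<^sup>2) * exp k"
    using t L by (intro mult_left_mono) (auto simp: k_def mult_left_le)
  finally have "(y t \<bullet> y t + C\<^sup>2) \<le> (y 0 \<bullet> y 0 + C\<^sup>2) * exp k" .
  then have "(norm (y t))\<^sup>2 \<le> ((norm (y 0))\<^sup>2 + C\<^sup>2) * exp k"
    using zero_le_power2[of C] unfolding power2_norm_eq_inner by linarith
  also have "\<dots> \<le> (norm (y 0) + C)\<^sup>2 * exp k"
    using C by (intro mult_right_mono) (auto simp: power2_sum)
  also have "\<dots> = ((norm (y 0) + C) * exp (L + 1))\<^sup>2"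
    by (simp add: k_def power_mult_distrib flip: exp_double)
  finally show ?thesis
    using C by (auto intro: power2_le_imp_le)
qed

lemma norm_growth_bound_backward:
  fixes y :: "real \<Rightarrow> 'a::real_inner"
  assumes der: "\<And>t. t \<in> {0..1} \<Longrightarrow> (y has_vector_derivative y' t) (at t within {0..1})"
    and bound: "\<And>t. t \<in> {0..1} \<Longrightarrow> norm (y' t) \<le> L * norm (y t) + C"
    and L: "L \<ge> 0" and C: "C \<ge> 0" and t: "t \<in> {0..1}"
  shows "norm (y t) \<le> (norm (y 1) + C) * exp (L + 1)"
proof -
  have "norm (y (1 - (1 - t))) \<le> (norm (y (1 - 0)) + C) * exp (L + 1)"
  proof (rule norm_growth_bound[where y = "\<lambda>t. y (1 - t)" and y' = "\<lambda>t. - y' (1 - t)"])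
    fix s :: real assume "s \<in> {0..1}"
    then show "((\<lambda>t. y (1 - t)) has_vector_derivative - y' (1 - s)) (at s within {0..1})"
      using has_vector_derivative_reverse_unit_interval[of y y' s] der by blast
    show "norm (- y' (1 - s)) \<le> L * norm (y (1 - s)) + C"
      using bound[of "1 - s"] \<open>s \<in> {0..1}\<close> by simp
  qed (use L C t in auto)
  then show ?thesis by simp
qed

text \<open>Shooting from the right end: \<open>w a\<close> transports \<open>a\<close> to time 1 by the linear equation and
  \<open>X q\<close> runs the coupled system backward from \<open>(q, P q)\<close>. The defect
  \<open>fst (X (w a 1) 0) - a\<close> is bounded because the nonlinearity \<open>g\<close> is, so Brouwer's theorem applies.\<close>

lemma two_point_boundary_value_problem:
  fixes A g :: "real \<Rightarrow> 'a::euclidean_space \<Rightarrow> 'a" and h :: "real \<Rightarrow> 'a \<times> 'a \<Rightarrow> 'a"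
  assumes linA: "\<And>t. t \<in> {0..1} \<Longrightarrow> linear (A t)"
    and contA: "continuous_on ({0..1} \<times> UNIV) (\<lambda>(t, x). A t x)"
    and contg: "continuous_on ({0..1} \<times> UNIV) (\<lambda>(t, x). g t x)"
    and conth: "continuous_on ({0..1} \<times> UNIV) (\<lambda>(t, x). h t x)"
    and A: "\<And>t x. t \<in> {0..1} \<Longrightarrow> norm (A t x) \<le> L * norm x"
    and g: "\<And>t x y. t \<in> {0..1} \<Longrightarrow> norm (g t x - g t y) \<le> L * norm (x - y)"
    and h: "\<And>t x y. t \<in> {0..1} \<Longrightarrow> norm (h t x - h t y) \<le> L * norm (x - y)"
    and P: "\<And>x y. norm (P x - P y) \<le> L * norm (x - y)"
    and gC: "\<And>t x. t \<in> {0..1} \<Longrightarrow> norm (g t x) \<le> C"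
    and L: "L \<ge> 0"
  obtains z p where "z 0 = c" "p 1 = P (z 1)"
    "\<And>t. t \<in> {0..1} \<Longrightarrow> (z has_vector_derivative A t (z t) + g t (p t)) (at t within {0..1})"
    "\<And>t. t \<in> {0..1} \<Longrightarrow> (p has_vector_derivative h t (z t, p t)) (at t within {0..1})"
proof -
  have C: "C \<ge> 0" using order_trans[OF norm_ge_zero gC[of 0 0]] by simp
  have Adiff: "A t x - A t y = A t (x - y)" if "t \<in> {0..1}" for t x y
    using linear_diff[OF linA[OF that]] by simp
  have "\<exists>w. w 0 = a \<and> (\<forall>t\<in>{0..1}. (w has_vector_derivative A t (w t)) (at t within {0..1}))" for a
  proof -
    obtain w where "w 0 = a" "\<And>t. t \<in> {0..1} \<Longrightarrow> (w has_vector_derivative A t (w t)) (at t within {0..1})"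
      by (rule picard_lindelof_unit_interval[OF contA, of L a]) (auto simp: Adiff A)
    then show ?thesis by blast
  qed
  then obtain w where w0: "w a 0 = a"
    and w: "t \<in> {0..1} \<Longrightarrow> (w a has_vector_derivative A t (w a t)) (at t within {0..1})" for a t
    by metis
  define F where "F t x = (A t (fst x) + g t (snd x), h t x)" for t x
  have contF: "continuous_on ({0..1} \<times> UNIV) (\<lambda>(t, x). F t x)"
  proof -
    have "continuous_on ({0..1} \<times> UNIV) (\<lambda>s. (\<lambda>(t, x). A t x) (fst s, fst (snd s)))"
      by (rule continuous_on_compose2[OF contA]) (auto intro!: continuous_intros)
    moreover have "continuous_on ({0..1} \<times> UNIV) (\<lambda>s. (\<lambda>(t, x). g t x) (fst s, snd (snd s)))"
      by (rule continuous_on_compose2[OF contg]) (auto intro!: continuous_intros)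
    ultimately show ?thesis
      using conth by (auto simp: F_def case_prod_beta intro!: continuous_intros)
  qed
  \<comment> \<open>The first component of \<open>F\<close> contributes one \<open>L\<close> for
    \<open>A\<close> and one for \<open>g\<close>, the second component one for
    \<open>h\<close>.\<close>
  have F: "norm (F t x - F t y) \<le> 3 * L * norm (x - y)" if t: "t \<in> {0..1}" for t x y
  proof -
    have "F t x - F t y = (A t (fst (x - y)) + (g t (snd x) - g t (snd y)), h t x - h t y)"
      using Adiff[OF t, of "fst x" "fst y"] by (simp add: F_def algebra_simps)
    then have "norm (F t x - F t y)
        \<le> norm (A t (fst (x - y)) + (g t (snd x) - g t (snd y))) + norm (h t x - h t y)"
      by (simp add: norm_Pair_le)
    also have "\<dots> \<le> L * norm (fst (x - y)) + L * norm (snd (x - y)) + L * norm (x - y)"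
      using A[OF t, of "fst (x - y)"] g[OF t, of "snd x" "snd y"] h[OF t, of x y]
        norm_triangle_ineq[of "A t (fst (x - y))" "g t (snd x) - g t (snd y)"] by simp
    also have "\<dots> \<le> L * norm (x - y) + L * norm (x - y) + L * norm (x - y)"
    proof (intro add_mono mult_left_mono L)
      show "norm (fst (x - y)) \<le> norm (x - y)" by (metis norm_fst_le prod.collapse)
      show "norm (snd (x - y)) \<le> norm (x - y)" by (metis norm_snd_le prod.collapse)
    qed simp
    finally show ?thesis by simp
  qed
  have "\<exists>X. X 1 = (q, P q) \<and> (\<forall>t\<in>{0..1}. (X has_vector_derivative F t (X t)) (at t within {0..1}))" for q
    by (rule picard_lindelof_unit_interval_backward[OF contF F, of "(q, P q)"]) auto
  then obtain X where X1: "X q 1 = (q, P q)"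
    and X: "t \<in> {0..1} \<Longrightarrow> (X q has_vector_derivative F t (X q t)) (at t within {0..1})" for q t
    by metis
  have Xfst: "((\<lambda>t. fst (X q t)) has_vector_derivative A t (fst (X q t)) + g t (snd (X q t)))
      (at t within {0..1})" if "t \<in> {0..1}" for q t
    using bounded_linear.has_vector_derivative[OF bounded_linear_fst X[OF that]] by (simp add: F_def)
  have Xsnd: "((\<lambda>t. snd (X q t)) has_vector_derivative h t (X q t)) (at t within {0..1})"
    if "t \<in> {0..1}" for q t
    using bounded_linear.has_vector_derivative[OF bounded_linear_snd X[OF that]] by (simp add: F_def)
  \<comment> \<open>Parametrising the terminal state by \<open>a\<close> through the linear flow is
    a preconditioning: for \<open>g = 0\<close> the backward run would return exactly to
    \<open>a\<close>, so \<open>E\<close> records the effect of \<open>g\<close> alone.\<close>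
  define E where "E a = fst (X (w a 1) 0) - a" for a
  define M where "M = C * exp (L + 1) + 1"
  have "M > 0" using C by (simp add: M_def add_nonneg_pos)
  have E_bound: "norm (E a) \<le> M" for a
  proof -
    \<comment> \<open>The difference of the two trajectories vanishes at time 1 and satisfies the
      linear equation with forcing \<open>g\<close>, which is bounded by \<open>C\<close>; hence
      \<open>C * exp (L + 1)\<close>. The additional 1 in \<open>M\<close> gives the ball a positive
      radius.\<close>
    define y where "y t = fst (X (w a 1) t) - w a t" for t
    have "norm (y 0) \<le> (norm (y 1) + C) * exp (L + 1)"
    proof (rule norm_growth_bound_backward)
      fix t :: real assume t: "t \<in> {0..1}"
      show "(y has_vector_derivative A t (y t) + g t (snd (X (w a 1) t))) (at t within {0..1})"
        unfolding y_def using has_vector_derivative_diff[OF Xfst[OF t, of "w a 1"] w[OF t, of a]]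
        by (simp add: add_diff_eq flip: Adiff[OF t])
          (simp add: algebra_simps)
      show "norm (A t (y t) + g t (snd (X (w a 1) t))) \<le> L * norm (y t) + C"
        by (intro norm_triangle_mono A gC t)
    qed (use L C in auto)
    then show ?thesis by (simp add: y_def X1 w0 E_def M_def)
  qed
  have w_lip: "norm (w a 1 - w b 1) \<le> norm (a - b) * exp (L + 1)" for a b
  proof -
    have "norm (w a 1 - w b 1) \<le> (norm (w a 0 - w b 0) + 0) * exp (L + 1)"
    proof (rule norm_growth_bound)
      fix t :: real assume t: "t \<in> {0..1}"
      show "((\<lambda>t. w a t - w b t) has_vector_derivative A t (w a t - w b t)) (at t within {0..1})"
        using has_vector_derivative_diff[OF w[OF t] w[OF t]] Adiff[OF t] by simp
      show "norm (A t (w a t - w b t)) \<le> L * norm (w a t - w b t) + 0"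
        using A[OF t] by simp
    qed (use L in auto)
    then show ?thesis by (simp add: w0)
  qed
  have X_lip: "norm (X q 0 - X r 0) \<le> (1 + L) * norm (q - r) * exp (3 * L + 1)" for q r
  proof -
    have "norm (X q 0 - X r 0) \<le> (norm (X q 1 - X r 1) + 0) * exp (3 * L + 1)"
    proof (rule norm_growth_bound_backward)
      fix t :: real assume t: "t \<in> {0..1}"
      show "((\<lambda>t. X q t - X r t) has_vector_derivative F t (X q t) - F t (X r t)) (at t within {0..1})"
        using has_vector_derivative_diff[OF X[OF t] X[OF t]] by simp
      show "norm (F t (X q t) - F t (X r t)) \<le> 3 * L * norm (X q t - X r t) + 0"
        using F[OF t] by simp
    qed (use L in auto)
    also have "\<dots> = norm (X q 1 - X r 1) * exp (3 * L + 1)" by simp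
    also have "norm (X q 1 - X r 1) \<le> (1 + L) * norm (q - r)"
      using norm_Pair_le[of "q - r" "P q - P r"] P[of q r] by (simp add: X1 algebra_simps)
    finally show ?thesis by simp
  qed
  \<comment> \<open>The factors belong to the linear flow (\<open>exp (L + 1)\<close>), to the
    terminal data \<open>(q, P q)\<close> (\<open>1 + L\<close>) and to the backward coupled flow
    (\<open>exp (3 * L + 1)\<close>). The estimate serves to make \<open>E\<close>
    continuous.\<close>
  define K where "K = (1 + L) * exp (L + 1) * exp (3 * L + 1)"
  have K_lip: "norm (fst (X (w a 1) 0) - fst (X (w b 1) 0)) \<le> K * norm (a - b)" for a b
  proof -
    have "norm (fst (X (w a 1) 0) - fst (X (w b 1) 0)) \<le> norm (X (w a 1) 0 - X (w b 1) 0)"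
      using norm_fst_le by (metis fst_diff prod.collapse)
    also have "\<dots> \<le> (1 + L) * norm (w a 1 - w b 1) * exp (3 * L + 1)"
      by (rule X_lip)
    also have "\<dots> \<le> (1 + L) * (norm (a - b) * exp (L + 1)) * exp (3 * L + 1)"
      using L by (intro mult_left_mono mult_right_mono w_lip) auto
    finally show ?thesis by (simp add: K_def mult_ac)
  qed
  have "K-lipschitz_on UNIV (\<lambda>a. fst (X (w a 1) 0))"
    using K_lip L by (intro lipschitz_onI) (auto simp: dist_norm K_def)
  then have "continuous_on UNIV (\<lambda>a. fst (X (w a 1) 0))"
    by (rule lipschitz_on_continuous_on)
  then have contE: "continuous_on UNIV E"
    unfolding E_def by (intro continuous_on_diff continuous_on_id)
  \<comment> \<open>As \<open>E\<close> is bounded by \<open>M\<close>, the map sends the ball of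
    radius \<open>M\<close> about \<open>c\<close> into itself. A fixed point satisfies
    \<open>a + E a = c\<close>, which is the missing initial condition.\<close>
  obtain a where a: "c - E a = a"
  proof (rule brouwer_ball[OF \<open>M > 0\<close>, of c "\<lambda>a. c - E a"])
    show "continuous_on (cball c M) (\<lambda>a. c - E a)"
      by (intro continuous_intros continuous_on_subset[OF contE]) auto
    show "(\<lambda>a. c - E a) \<in> cball c M \<rightarrow> cball c M"
      using E_bound by (auto simp: dist_norm)
  qed blast
  show ?thesis
  proof (rule that[of "\<lambda>t. fst (X (w a 1) t)" "\<lambda>t. snd (X (w a 1) t)"])
    show "fst (X (w a 1) 0) = c" using a by (simp add: E_def algebra_simps)
    show "snd (X (w a 1) 1) = P (fst (X (w a 1) 1))" by (simp add: X1)
  qed (use Xfst Xsnd in auto)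
qed

section \<open>Absolutely continuous functions\<close>

lemma abs_cont01E:
  assumes "abs_cont01 f" "e > 0"
  obtains \<delta> where "\<delta> > 0"
    "\<And>d T. d division_of T \<Longrightarrow> T \<subseteq> {0..1} \<Longrightarrow> (\<Sum>k\<in>d. Sup k - Inf k) < \<delta> \<Longrightarrow>
      (\<Sum>k\<in>d. norm (f (Sup k) - f (Inf k))) < e"
proof -
  have "\<exists>\<delta>>0. \<forall>d T. d division_of T \<longrightarrow> T \<subseteq> {0..1} \<longrightarrow>
     (\<Sum>k\<in>d. Sup k - Inf k) < \<delta> \<longrightarrow> (\<Sum>k\<in>d. norm (f (Sup k) - f (Inf k))) < e"
    using assms unfolding abs_cont01_def by blast
  then obtain \<delta> where "\<delta> > 0 \<and> (\<forall>d T. d division_of T \<longrightarrow> T \<subseteq> {0..1} \<longrightarrow>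
     (\<Sum>k\<in>d. Sup k - Inf k) < \<delta> \<longrightarrow> (\<Sum>k\<in>d. norm (f (Sup k) - f (Inf k))) < e)" ..
  then show ?thesis by (intro that[of \<delta>]) blast+
qed

text \<open>Intervals of a division overlap only in null sets, so their total length is the measure
  of their union. This turns a small open cover of a null set into the smallness condition of
  absolute continuity.\<close>

lemma sum_content_division_le_measure:
  assumes div: "\<D> division_of \<Union>\<D>" and sub: "\<Union>\<D> \<subseteq> U" and U: "U \<in> lmeasurable"
  shows "sum (measure lborel) \<D> \<le> measure lebesgue U"
proof -
  note d = division_ofD[OF div]
  have meas: "K \<in> lmeasurable" if "K \<in> \<D>" for K
    using d(4)[OF that] by auto
  have "negligible (K \<inter> L)" if "K \<in> \<D>" "L \<in> \<D>" "K \<noteq> L" for K L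
  proof -
    have "interior (K \<inter> L) = {}"
      using d(5)[OF that] by simp
    moreover obtain a b c e where KL: "K = cbox a b" "L = cbox c e"
      using d(4)[OF \<open>K \<in> \<D>\<close>] d(4)[OF \<open>L \<in> \<D>\<close>] by blast
    ultimately show ?thesis
      unfolding KL Int_interval negligible_interval interior_cbox by simp
  qed
  then have "pairwise (\<lambda>K L. negligible (K \<inter> L)) \<D>"
    by (auto simp: pairwise_def)
  then have "measure lebesgue (\<Union>\<D>) = (\<Sum>K\<in>\<D>. measure lebesgue K)"
    using d(1) meas by (intro measure_negligible_finite_Union) auto
  also have "\<dots> = sum (measure lborel) \<D>"
  proof (rule sum.cong)
    fix K assume "K \<in> \<D>"
    then obtain a b where "K = cbox a b" using d(4) by blast
    then show "measure lebesgue K = measure lborel K" by (simp add: measure_completion)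
  qed simp
  finally have "sum (measure lborel) \<D> = measure lebesgue (\<Union>\<D>)" ..
  also have "\<dots> \<le> measure lebesgue U"
    using meas d(1) by (intro measure_mono_fmeasurable sub U) (auto intro: fmeasurableD)
  finally show ?thesis .
qed

text \<open>Cover the exceptional null set \<open>N\<close> by an open set of measure below the
  absolute-continuity threshold: intervals tagged in \<open>N\<close> then contribute little to \<open>f 1 - f 0\<close>.\<close>

lemma abs_cont01_has_integral_derivative:
  fixes f :: "real \<Rightarrow> 'a::banach"
  assumes ac: "abs_cont01 f"
    and der: "AE t in leb01. (f has_vector_derivative g t) (at t within {0..1})"
  shows "(g has_integral (f 1 - f 0)) {0..1}"
proof -
  define N where "N = {t \<in> {0..1}. \<not> (f has_vector_derivative g t) (at t within {0..1})}"
  have N0: "N \<in> null_sets lebesgue"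
  proof -
    obtain N' where N': "N' \<in> null_sets leb01" "N \<subseteq> N'"
      using der unfolding eventually_ae_filter N_def by auto
    then have "N' \<in> null_sets lebesgue"
      by (simp add: null_sets_restrict_space)
    then show ?thesis
      using N'(2) by (meson negligible_iff_null_sets negligible_subset)
  qed
  \<comment> \<open>With the integrand zero on \<open>N\<close>, an interval tagged in
    \<open>N\<close> contributes only its increment of \<open>f\<close>. The change is confined to a
    null set and is undone by the final spike argument.\<close>
  define g' where "g' t = (if t \<in> N then 0 else g t)" for t
  have "(g' has_integral (f 1 - f 0)) (cbox 0 1)"
    unfolding has_integral_factor_content
  proof safe
    fix e :: real assume e: "e > 0"
    obtain \<delta> where \<delta>: "\<delta> > 0" and
      ac': "\<And>d T. d division_of T \<Longrightarrow> T \<subseteq> {0..1} \<Longrightarrow> (\<Sum>k\<in>d. Sup k - Inf k) < \<delta> \<Longrightarrow>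
         (\<Sum>k\<in>d. norm (f (Sup k) - f (Inf k))) < e/2"
      using abs_cont01E[OF ac, of "e/2"] e by auto
    obtain U where U: "open U" "N \<subseteq> U" "U - N \<in> lmeasurable" "emeasure lebesgue (U - N) < ennreal \<delta>"
      using sets_lebesgue_outer_open[of N \<delta>] N0 \<delta> by auto
    have Um: "U \<in> lmeasurable" "measure lebesgue U < \<delta>"
    proof -
      have *: "emeasure lebesgue U = emeasure lebesgue (U - N)"
        using N0 U(1) by (simp add: emeasure_Diff_null_set)
      then have "emeasure lebesgue U < ennreal \<delta>" using U(4) by simp
      then show "U \<in> lmeasurable"
        using U(1) by (intro fmeasurableI) (auto intro: less_trans)
      show "measure lebesgue U < \<delta>"
        using \<open>emeasure lebesgue U < ennreal \<delta>\<close> \<delta> \<open>U \<in> lmeasurable\<close>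
        by (simp add: emeasure_eq_measure2 ennreal_less_iff)
    qed
    \<comment> \<open>The gauge has two regimes: off \<open>N\<close> it is the radius of the linear
      approximation with error \<open>e/2\<close>, on \<open>N\<close> it keeps the interval inside
      \<open>U\<close>.\<close>
    have "\<exists>d>0. (t \<in> {0..1} - N \<longrightarrow> (\<forall>y\<in>{0..1}. norm (y - t) < d \<longrightarrow>
         norm (f y - f t - (y - t) *\<^sub>R g t) \<le> e/2 * norm (y - t))) \<and> (t \<in> N \<longrightarrow> ball t d \<subseteq> U)" for t
    proof (cases "t \<in> N")
      case True
      then show ?thesis using U(1,2) by (auto simp: N_def open_contains_ball)
    next
      case False
      show ?thesis
      proof (cases "t \<in> {0..1}")
        case True
        then have "(f has_vector_derivative g t) (at t within {0..1})"
          using False by (simp add: N_def)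
        then show ?thesis
          using e False unfolding has_vector_derivative_def has_derivative_within_alt
          by (meson half_gt_zero)
      qed (use False in \<open>auto intro: exI[of _ 1]\<close>)
    qed
    then obtain d where d: "\<And>t. d t > 0"
      "\<And>t y. t \<in> {0..1} - N \<Longrightarrow> y \<in> {0..1} \<Longrightarrow> norm (y - t) < d t \<Longrightarrow>
         norm (f y - f t - (y - t) *\<^sub>R g t) \<le> e/2 * norm (y - t)"
      "\<And>t. t \<in> N \<Longrightarrow> ball t (d t) \<subseteq> U"
      by metis
    show "\<exists>d. gauge d \<and> (\<forall>p. p tagged_division_of (cbox 0 1) \<and> d fine p \<longrightarrow>
      norm ((\<Sum>(x, k)\<in>p. measure lborel k *\<^sub>R g' x) - (f 1 - f 0)) \<le> e * measure lborel (cbox 0 (1::real)))"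
    proof (rule exI, safe)
      show "gauge (\<lambda>x. ball x (d x))"
        using d(1) gauge_ball_dependent by blast
    next
      fix p assume p: "p tagged_division_of cbox 0 (1::real)" and fine: "(\<lambda>x. ball x (d x)) fine p"
      note td = tagged_division_ofD[OF p]
      have K: "\<exists>u v. K = {u..v} \<and> u \<le> x \<and> x \<le> v \<and> 0 \<le> u \<and> v \<le> 1 \<and> Sup K = v \<and> Inf K = u \<and>
           measure lborel K = v - u \<and> \<bar>u - x\<bar> < d x \<and> \<bar>v - x\<bar> < d x" if xK: "(x, K) \<in> p" for x K
      proof -
        obtain u v where uv: "K = {u..v}" using td(4)[OF xK] by auto
        have x: "u \<le> x" "x \<le> v" using td(2)[OF xK] uv by auto
        have "K \<subseteq> ball x (d x)" using fine xK by (auto simp: fine_def)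
        moreover have "u \<in> K" "v \<in> K" using x uv by auto
        ultimately have "\<bar>u - x\<bar> < d x" "\<bar>v - x\<bar> < d x"
          by (auto simp: dist_real_def abs_minus_commute)
        moreover have "0 \<le> u" "v \<le> 1" using td(3)[OF xK] x uv by auto
        ultimately show ?thesis using x uv by auto
      qed
      define D where "D = (\<lambda>(x, K). measure lborel K *\<^sub>R g' x - (f (Sup K) - f (Inf K)))"
      define q where "q = {(x, K) \<in> p. x \<in> N}"
      have q: "q \<subseteq> p" by (auto simp: q_def)
      have qtd: "q tagged_division_of \<Union>(snd ` q)"
        using tagged_partial_division_of_Union_self tagged_partial_division_subset[OF _ q] p
        by (auto simp: tagged_division_of_def)
      have qdiv: "snd ` q division_of \<Union>(snd ` q)"
        by (rule division_of_tagged_division[OF qtd])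
      have bad: "norm (sum D q) \<le> e/2"
      proof -
        have "norm (sum D q) \<le> (\<Sum>(x, K)\<in>q. norm (f (Sup K) - f (Inf K)))"
          by (rule sum_norm_le) (auto simp: q_def D_def g'_def norm_minus_commute)
        also have "\<dots> = (\<Sum>K\<in>snd ` q. norm (f (Sup K) - f (Inf K)))"
        proof -
          have "(\<Sum>K\<in>snd ` q. norm (f (Sup K) - f (Inf K))) =
              sum ((\<lambda>K. norm (f (Sup K) - f (Inf K))) \<circ> snd) q"
          proof (rule sum.reindex_nontrivial)
            show "finite q" by (rule finite_subset[OF q td(1)])
            \<comment> \<open>One interval may carry two different tags, but then it has empty
              interior, hence is a single point with zero increment.\<close>
            fix x y assume xy: "x \<in> q" "y \<in> q" "x \<noteq> y" "snd x = snd y"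
            have xyp: "(fst x, snd x) \<in> p" "(fst y, snd y) \<in> p" "(fst x, snd x) \<noteq> (fst y, snd y)"
              using subsetD[OF q xy(1)] subsetD[OF q xy(2)] xy(3) by simp_all
            then have "interior (snd x \<inter> snd y) = {}"
              using td(5)[OF xyp] by simp
            then have "interior (snd x) = {}" using xy(4) by simp
            moreover obtain u v where "snd x = {u..v}" "Sup (snd x) = v" "Inf (snd x) = u" "u \<le> v"
              using K[OF xyp(1)] order_trans by blast
            ultimately show "norm (f (Sup (snd x)) - f (Inf (snd x))) = 0"
              by (auto simp: interior_atLeastAtMost_real)
          qed
          then show ?thesis by (simp add: o_def case_prod_beta)
        qed
        also have "\<dots> < e/2"
        proof (rule ac'[OF qdiv])
          show "\<Union> (snd ` q) \<subseteq> {0..1}" using td(3) q by fastforce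
          have "(\<Sum>K\<in>snd ` q. Sup K - Inf K) = sum (measure lborel) (snd ` q)"
          proof (rule sum.cong)
            fix L assume "L \<in> snd ` q"
            then obtain x where "(x, L) \<in> p" using q by auto
            from K[OF this] show "Sup L - Inf L = measure lborel L" by auto
          qed simp
          also have "\<dots> \<le> measure lebesgue U"
          proof (rule sum_content_division_le_measure[OF qdiv])
            show "\<Union> (snd ` q) \<subseteq> U"
            proof safe
              fix x K t assume "(x, K) \<in> q" "t \<in> snd (x, K)"
              then have "x \<in> N" "t \<in> ball x (d x)"
                using fineD[OF fine, of x K] by (auto simp: q_def)
              then show "t \<in> U" using d(3) by blast
            qed
          qed (rule Um)
          finally show "(\<Sum>K\<in>snd ` q. Sup K - Inf K) < \<delta>" using Um(2) by simp
        qed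
        finally show ?thesis by simp
      qed
      have good: "norm (sum D (p - q)) \<le> e/2"
      proof -
        have "norm (sum D (p - q)) \<le> (\<Sum>(x, K)\<in>p - q. e/2 * measure lborel K)"
        proof (rule sum_norm_le, clarify)
          fix x K assume xK: "(x, K) \<in> p" "(x, K) \<notin> q"
          then have "x \<notin> N" by (auto simp: q_def)
          obtain u v where uv: "K = {u..v}" "u \<le> x" "x \<le> v" "0 \<le> u" "v \<le> 1" "Sup K = v"
            "Inf K = u" "measure lborel K = v - u" "\<bar>u - x\<bar> < d x" "\<bar>v - x\<bar> < d x"
            using K[OF xK(1)] by blast
          have "norm (f u - f x - (u - x) *\<^sub>R g x) \<le> e/2 * (x - u)"
            using d(2)[of x u] \<open>x \<notin> N\<close> uv by auto
          moreover have "norm (f v - f x - (v - x) *\<^sub>R g x) \<le> e/2 * (v - x)"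
            using d(2)[of x v] \<open>x \<notin> N\<close> uv by auto
          \<comment> \<open>The tag lies between the end points, so the two one-sided errors are
            proportional to \<open>x - u\<close> and \<open>v - x\<close> and add up to
            \<open>e/2\<close> times the length of the interval.\<close>
          moreover have "D (x, K) = (f u - f x - (u - x) *\<^sub>R g x) - (f v - f x - (v - x) *\<^sub>R g x)"
            using \<open>x \<notin> N\<close> uv by (simp add: D_def g'_def algebra_simps)
          ultimately have "norm (D (x, K)) \<le> e/2 * (x - u) + e/2 * (v - x)"
            using norm_triangle_ineq4 by (smt (verit))
          then show "norm (D (x, K)) \<le> e/2 * measure lborel K"
            using uv by (simp add: field_simps)
        qed
        also have "\<dots> \<le> (\<Sum>(x, K)\<in>p. e/2 * measure lborel K)"
          using e td(1) by (intro sum_mono2) auto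
        also have "\<dots> = e/2"
          using additive_content_tagged_division[OF p]
          by (simp add: case_prod_beta flip: sum_distrib_left sum_divide_distrib)
        finally show ?thesis .
      qed
      have "(\<Sum>(x, k)\<in>p. measure lborel k *\<^sub>R g' x) - (f 1 - f 0) = sum D p"
        using additive_tagged_division_1[of 0 1 p f] p
        by (simp add: D_def case_prod_beta sum_subtractf)
      also have "\<dots> = sum D (p - q) + sum D q"
        using sum.subset_diff[OF q td(1)] .
      finally show "norm ((\<Sum>(x, k)\<in>p. measure lborel k *\<^sub>R g' x) - (f 1 - f 0)) \<le> e * measure lborel (cbox 0 (1::real))"
        using bad good norm_triangle_ineq[of "sum D (p - q)" "sum D q"] by simp
    qed
  qed
  then have "(g' has_integral (f 1 - f 0)) {0..1}" by simp
  then show ?thesis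
    using N0 by (rule_tac has_integral_spike[of N]) (auto simp: g'_def negligible_iff_null_sets)
qed

section \<open>Closure properties of absolute continuity and membership in
  \<open>W12\<close>\<close>

lemma abs_cont01_imp_continuous_on:
  assumes "abs_cont01 f"
  shows "continuous_on {0..1} f"
  unfolding continuous_on_iff
proof (intro ballI allI impI)
  fix x e :: real assume x: "x \<in> {0..1}" and "e > 0"
  then obtain \<delta> where \<delta>: "\<delta> > 0" and
    ac: "\<And>d T. d division_of T \<Longrightarrow> T \<subseteq> {0..1} \<Longrightarrow> (\<Sum>k\<in>d. Sup k - Inf k) < \<delta> \<Longrightarrow>
       (\<Sum>k\<in>d. norm (f (Sup k) - f (Inf k))) < e"
    using abs_cont01E[OF assms] by blast
  have *: "dist (f u) (f v) < e" if "u \<le> v" "u \<in> {0..1}" "v \<in> {0..1}" "v - u < \<delta>" for u v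
    using ac[of "{{u..v}}" "{u..v}"] that division_of_self[of u v]
    by (auto simp: dist_norm norm_minus_commute)
  show "\<exists>d>0. \<forall>x'\<in>{0..1}. dist x' x < d \<longrightarrow> dist (f x') (f x) < e"
  proof (intro exI[of _ \<delta>] conjI \<delta> ballI impI)
    fix x' assume "x' \<in> {0..1}" "dist x' x < \<delta>"
    then show "dist (f x') (f x) < e"
      using *[of x x'] *[of x' x] x by (cases "x \<le> x'") (auto simp: dist_commute dist_real_def)
  qed
qed

text \<open>A comparison criterion: increments of \<open>h\<close> inherit smallness from those of
  \<open>f\<close> and \<open>g\<close>. Two comparison functions are allowed because the increment
  of a product involves both factors; Lipschitz images use it with \<open>f = g\<close>.\<close>

lemma abs_cont01_bound:
  assumes "abs_cont01 f" "abs_cont01 g" "B > 0"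
    and le: "\<And>s t. s \<in> {0..1} \<Longrightarrow> t \<in> {0..1} \<Longrightarrow>
      norm (h s - h t) \<le> B * (norm (f s - f t) + norm (g s - g t))"
  shows "abs_cont01 h"
  unfolding abs_cont01_def
proof (intro allI impI)
  fix e :: real assume "e > 0"
  then have e: "e / (2 * B) > 0" using \<open>B > 0\<close> by simp
  obtain \<delta>1 where \<delta>1: "\<delta>1 > 0" and
    f: "\<And>d T. d division_of T \<Longrightarrow> T \<subseteq> {0..1} \<Longrightarrow> (\<Sum>k\<in>d. Sup k - Inf k) < \<delta>1 \<Longrightarrow>
       (\<Sum>k\<in>d. norm (f (Sup k) - f (Inf k))) < e / (2 * B)"
    using abs_cont01E[OF assms(1) e] by blast
  obtain \<delta>2 where \<delta>2: "\<delta>2 > 0" and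
    g: "\<And>d T. d division_of T \<Longrightarrow> T \<subseteq> {0..1} \<Longrightarrow> (\<Sum>k\<in>d. Sup k - Inf k) < \<delta>2 \<Longrightarrow>
       (\<Sum>k\<in>d. norm (g (Sup k) - g (Inf k))) < e / (2 * B)"
    using abs_cont01E[OF assms(2) e] by blast
  show "\<exists>\<delta>>0. \<forall>d T. d division_of T \<longrightarrow> T \<subseteq> {0..1} \<longrightarrow> (\<Sum>k\<in>d. Sup k - Inf k) < \<delta> \<longrightarrow>
      (\<Sum>k\<in>d. norm (h (Sup k) - h (Inf k))) < e"
  proof (intro exI[of _ "min \<delta>1 \<delta>2"] conjI allI impI)
    fix d T assume d: "d division_of T" "T \<subseteq> {0..1::real}" "(\<Sum>k\<in>d. Sup k - Inf k) < min \<delta>1 \<delta>2"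
    have "(\<Sum>k\<in>d. norm (h (Sup k) - h (Inf k)))
        \<le> (\<Sum>k\<in>d. B * (norm (f (Sup k) - f (Inf k)) + norm (g (Sup k) - g (Inf k))))"
    proof (intro sum_mono le)
      fix k assume k: "k \<in> d"
      then obtain u v where "k = {u..v}" "u \<le> v"
        using division_ofD(3,4)[OF d(1) k] by auto
      moreover have "k \<subseteq> {0..1}" using division_ofD(2)[OF d(1) k] d(2) by auto
      ultimately show "Sup k \<in> {0..1}" "Inf k \<in> {0..1}" by auto
    qed
    also have "\<dots> = B * ((\<Sum>k\<in>d. norm (f (Sup k) - f (Inf k))) + (\<Sum>k\<in>d. norm (g (Sup k) - g (Inf k))))"
      by (simp add: sum.distrib flip: sum_distrib_left)
    also have "\<dots> < B * (e / (2 * B) + e / (2 * B))"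
      using f[OF d(1,2)] g[OF d(1,2)] d(3) \<open>B > 0\<close> by (intro mult_strict_left_mono add_strict_mono) auto
    also have "\<dots> = e" using \<open>B > 0\<close> by (simp add: field_simps)
    finally show "(\<Sum>k\<in>d. norm (h (Sup k) - h (Inf k))) < e" .
  qed (use \<delta>1 \<delta>2 in auto)
qed

lemma abs_cont01_inner:
  fixes f g :: "real \<Rightarrow> 'a::real_inner"
  assumes f: "abs_cont01 f" and g: "abs_cont01 g"
  shows "abs_cont01 (\<lambda>t. f t \<bullet> g t)"
proof -
  have "bounded (f ` {0..1})" "bounded (g ` {0..1})"
    using f g by (auto intro!: compact_imp_bounded compact_continuous_image abs_cont01_imp_continuous_on)
  then obtain F G where F: "F > 0" "\<And>t. t \<in> {0..1} \<Longrightarrow> norm (f t) \<le> F"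
    and G: "G > 0" "\<And>t. t \<in> {0..1} \<Longrightarrow> norm (g t) \<le> G"
    unfolding bounded_pos by blast
  show ?thesis
  proof (rule abs_cont01_bound[OF f g, of "F + G"])
    fix s t :: real assume st: "s \<in> {0..1}" "t \<in> {0..1}"
    have "f s \<bullet> g s - f t \<bullet> g t = (f s - f t) \<bullet> g s + f t \<bullet> (g s - g t)"
      by (simp add: algebra_simps)
    also have "norm \<dots> \<le> norm (f s - f t) * norm (g s) + norm (f t) * norm (g s - g t)"
      by (intro norm_triangle_mono) (simp_all add: Cauchy_Schwarz_ineq2)
    also have "\<dots> \<le> norm (f s - f t) * (F + G) + (F + G) * norm (g s - g t)"
      using F(1) F(2)[OF st(2)] G(1) G(2)[OF st(1)] by (intro add_mono mult_left_mono mult_right_mono) auto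
    finally show "norm (f s \<bullet> g s - f t \<bullet> g t) \<le> (F + G) * (norm (f s - f t) + norm (g s - g t))"
      by (simp add: algebra_simps)
  qed (use F G in auto)
qed

lemma W12_continuous: "f \<in> W12 \<Longrightarrow> continuous_on {0..1} f"
  by (simp add: W12_def abs_cont01_imp_continuous_on)

lemma W12_derivative:
  "f \<in> W12 \<Longrightarrow> AE t in leb01. (f has_vector_derivative ddt f t) (at t within {0..1})"
  by (simp add: W12_def ddt_def vector_derivative_works)

text \<open>The derivative is bounded on the compact interval, so the function is Lipschitz, and
  comparison with the identity gives absolute continuity. This brings the classical extremal into
  \<open>W12\<close>.\<close>

lemma continuously_differentiable_in_W12:
  fixes f :: "real \<Rightarrow> 'a::euclidean_space"
  assumes der: "\<And>t. t \<in> {0..1} \<Longrightarrow> (f has_vector_derivative f' t) (at t within {0..1})"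
    and cont: "continuous_on {0..1} f'"
  shows "f \<in> W12"
proof -
  have ddt: "ddt f t = f' t" if "t \<in> {0..1}" for t
    unfolding ddt_def using der[OF that] that by (intro vector_derivative_within_closed_interval) auto
  obtain B where B: "B > 0" "\<And>t. t \<in> {0..1} \<Longrightarrow> norm (f' t) \<le> B"
    using compact_imp_bounded[OF compact_continuous_image[OF cont]] unfolding bounded_pos
    by (auto simp: image_iff)
  have lip: "norm (f s - f t) \<le> B * norm (s - t)" if "s \<in> {0..1}" "t \<in> {0..1}" for s t
  proof (rule differentiable_bound[of "{0..1}" f "\<lambda>t h. h *\<^sub>R f' t"])
    show "(f has_derivative (\<lambda>h. h *\<^sub>R f' x)) (at x within {0..1})" if "x \<in> {0..1}" for x
      using der[OF that] by (simp add: has_vector_derivative_def)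
    show "onorm (\<lambda>h. h *\<^sub>R f' x) \<le> B" if "x \<in> {0..1}" for x
      using B(2)[OF that] by (intro onorm_le) (simp add: mult.commute[of B] mult_left_mono)
  qed (use that in auto)
  have id: "abs_cont01 (\<lambda>t::real. t)"
    unfolding abs_cont01_def
  proof (intro allI impI exI conjI)
    fix e :: real and d T assume "e > 0" and d: "d division_of T" "(\<Sum>k\<in>d. Sup k - Inf k) < e"
    have "norm (Sup k - Inf k) = Sup k - Inf k" if "k \<in> d" for k :: "real set"
      using division_ofD(3,4)[OF d(1) that] by auto
    then show "(\<Sum>k\<in>d. norm (Sup k - Inf k)) < e" using d(2) by simp
  qed
  have "abs_cont01 f"
  proof (rule abs_cont01_bound[OF id id])
    show "norm (f s - f t) \<le> B * (norm (s - t) + norm (s - t))" if "s \<in> {0..1}" "t \<in> {0..1}" for s t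
      by (rule order_trans[OF lip[OF that]]) (use B(1) in \<open>auto intro!: mult_left_mono\<close>)
  qed (rule B)
  moreover have "AE t in leb01. f differentiable (at t within {0..1})"
    using der by (intro AE_I2) (auto simp: differentiable_def has_vector_derivative_def)
  moreover have "ddt f \<in> L2"
  proof -
    have c: "continuous_on {0..1} (ddt f)"
      by (rule continuous_on_eq[OF cont]) (simp add: ddt)
    then have "continuous_on {0..1} (\<lambda>t. (norm (ddt f t))\<^sup>2)" by (intro continuous_intros)
    then show ?thesis
      unfolding L2_def using c
      by (auto intro: continuous_imp_measurable_on_sets_lebesgue continuous_imp_integrable_real)
  qed
  ultimately show ?thesis by (simp add: W12_def)
qed

section \<open>Matrices and block structure\<close>

lemma bounded_bilinear_matrix_vector_mult:
  "bounded_bilinear (\<lambda>(A :: real^'n^'m) x. A *v x)"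
  unfolding bilinear_conv_bounded_bilinear[symmetric] bilinear_def
  by (auto intro!: linearI simp: algebra_simps matrix_vector_right_distrib scaleR_matrix_vector_assoc)

lemma bounded_bilinear_vector_matrix_mult:
  "bounded_bilinear (\<lambda>(A :: real^'n^'m) x. x v* A)"
  unfolding bilinear_conv_bounded_bilinear[symmetric] bilinear_def
  by (auto intro!: linearI simp: vec_eq_iff vector_matrix_mult_def sum.distrib sum_distrib_left algebra_simps)

lemmas continuous_on_matrix_vector_mult [continuous_intros] =
  bounded_bilinear.continuous_on[OF bounded_bilinear_matrix_vector_mult]

lemmas continuous_on_vector_matrix_mult [continuous_intros] =
  bounded_bilinear.continuous_on[OF bounded_bilinear_vector_matrix_mult]

lemma bounded_bilinear_uniform_bound:
  assumes h: "bounded_bilinear h" and M: "continuous_on {0..1::real} M"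
  obtains K where "K \<ge> 0" "\<And>t x. t \<in> {0..1} \<Longrightarrow> norm (h (M t) x) \<le> K * norm x"
proof -
  obtain k where k: "k \<ge> 0" "\<And>a x. norm (h a x) \<le> norm a * norm x * k"
    using bounded_bilinear.nonneg_bounded[OF h] by blast
  obtain B where B: "B > 0" "\<And>t. t \<in> {0..1} \<Longrightarrow> norm (M t) \<le> B"
    using compact_imp_bounded[OF compact_continuous_image[OF M]] unfolding bounded_pos
    by (auto simp: image_iff)
  show ?thesis
  proof (rule that[of "B * k"])
    fix t x assume "t \<in> {0..1::real}"
    have "norm (h (M t) x) \<le> norm (M t) * norm x * k" by (rule k)
    also have "\<dots> \<le> B * norm x * k"
      using k(1) B(2)[OF \<open>t \<in> {0..1}\<close>] by (intro mult_right_mono) auto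
    finally show "norm (h (M t) x) \<le> B * k * norm x" by (simp add: mult_ac)
  qed (use k B in auto)
qed

lemma continuous_on_stack [continuous_intros]:
  fixes f :: "'b::topological_space \<Rightarrow> 'a::topological_space^'m" and g :: "'b \<Rightarrow> 'a^'n"
  assumes "continuous_on T f" "continuous_on T g"
  shows "continuous_on T (\<lambda>t. stack (f t) (g t))"
  unfolding stack_def
proof (rule continuous_on_vec_lambda)
  show "continuous_on T (\<lambda>t. case i of Inl a \<Rightarrow> f t $ a | Inr b \<Rightarrow> g t $ b)" for i
    using assms by (cases i) (auto simp: continuous_on_def intro: tendsto_vec_nth)
qed

lemma continuous_on_vec_nth_topological:
  fixes f :: "'b::topological_space \<Rightarrow> 'a::topological_space^'m"
  shows "continuous_on T f \<Longrightarrow> continuous_on T (\<lambda>t. f t $ i)"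
  by (auto simp: continuous_on_def intro: tendsto_vec_nth)

lemma continuous_on_block_mat [continuous_intros]:
  fixes A :: "real \<Rightarrow> real^'m^'m" and D :: "real \<Rightarrow> real^'n^'n"
  assumes "continuous_on T A" "continuous_on T B" "continuous_on T C" "continuous_on T D"
  shows "continuous_on T (\<lambda>t. block_mat (A t) (B t) (C t) (D t))"
  unfolding block_mat_def
  using assms by (intro continuous_intros continuous_on_vec_nth_topological)

lemma smooth01_continuously_differentiable:
  assumes "smooth01 f"
  obtains f' where "continuous_on {0..1} f'"
    "\<And>t. t \<in> {0..1} \<Longrightarrow> (f has_vector_derivative f' t) (at t within {0..1})"
proof -
  obtain F where F: "F 0 = f"
    "\<And>i t. t \<in> {0..1} \<Longrightarrow> (F i has_vector_derivative F (Suc i) t) (at t within {0..1})"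
    using assms unfolding smooth01_def by blast
  show ?thesis
  proof (rule that[of "F 1"])
    show "continuous_on {0..1} (F 1)"
      unfolding continuous_on_eq_continuous_within
      using F(2)[of _ 1] has_vector_derivative_continuous by blast
  qed (use F(2)[of _ 0] F(1) in auto)
qed

lemma smooth01_imp_continuous_on:
  assumes "smooth01 f"
  shows "continuous_on {0..1} f"
  using smooth01_continuously_differentiable[OF assms] has_vector_derivative_continuous
  unfolding continuous_on_eq_continuous_within by metis

section \<open>Calculus of the scaling matrix \<open>I_eps\<close>\<close>

lemma I_eps_mult:
  fixes x :: "real^('m::finite + 'n::finite)"
  shows "I_eps e *v x = (\<chi> i. case i of Inl a \<Rightarrow> x $ i | Inr b \<Rightarrow> e * x $ i)"
proof -
  have "I_eps e $ i $ j = (if j = i then case i of Inl a \<Rightarrow> 1 | Inr b \<Rightarrow> e else 0)"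
    for i j :: "'m + 'n"
    by (auto simp: I_eps_def block_mat_def stack_def mat_def split: sum.split)
  then show ?thesis
    by (auto simp: matrix_vector_mult_def vec_eq_iff if_distrib[of "\<lambda>x. x * _"] split: sum.split
        cong: if_cong)
qed

lemma I_eps_inverse: "e \<noteq> 0 \<Longrightarrow> I_eps e *v (I_eps (1 / e) *v x) = x"
  by (auto simp: I_eps_mult vec_eq_iff split: sum.split)

lemma inner_I_eps: "(I_eps e *v x) \<bullet> y = x \<bullet> (I_eps e *v y)"
  by (auto simp: I_eps_mult inner_vec_def intro!: sum.cong split: sum.split)

lemma vector_matrix_mult_I_eps: "x v* I_eps e = I_eps e *v x"
proof -
  have "(x v* I_eps e) \<bullet> y = (I_eps e *v x) \<bullet> y" for y
    by (simp add: dot_lmul_matrix inner_I_eps)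
  then show ?thesis using vector_eq_rdot by blast
qed

section \<open>Positive definite matrices and conjugates of quadratic forms\<close>

lemma pos_def_matrix_inv:
  fixes M :: "real^'n^'n"
  assumes "pos_def M"
  shows "M ** matrix_inv M = mat 1" "matrix_inv M ** M = mat 1"
proof -
  have "\<forall>x. M *v x = 0 \<longrightarrow> x = 0"
    using assms unfolding pos_def_def by (metis inner_zero_right less_irrefl)
  then have "invertible M"
    by (simp add: invertible_left_inverse matrix_left_invertible_ker)
  then have "\<exists>B. M ** B = mat 1 \<and> B ** M = mat 1"
    by (simp add: invertible_def)
  from someI_ex[OF this] show "M ** matrix_inv M = mat 1" "matrix_inv M ** M = mat 1"
    by (simp_all add: matrix_inv_def)
qed

lemma pos_def_matrix_inv_mult:
  fixes M :: "real^'n^'n"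
  assumes "pos_def M"
  shows "M *v (matrix_inv M *v x) = x" "matrix_inv M *v (M *v x) = x"
  by (simp_all add: matrix_vector_mul_assoc pos_def_matrix_inv[OF assms])

lemma pos_def_det_nonzero:
  fixes M :: "real^'n^'n"
  assumes "pos_def M"
  shows "det M \<noteq> 0"
  using pos_def_matrix_inv[OF assms] invertible_det_nz[of M] unfolding invertible_def by blast

lemma symmetric_inner:
  fixes M :: "real^'n^'n"
  assumes "transpose M = M"
  shows "x \<bullet> (M *v y) = y \<bullet> (M *v x)"
  by (metis assms dot_lmul_matrix inner_commute transpose_matrix_vector)

text \<open>The Fenchel-Young inequality for half the quadratic form of \<open>M\<close>: with
  \<open>w = matrix_inv M *v y\<close> the left side is half the form evaluated at
  \<open>x - w\<close>.\<close>

lemma conjugate_quadratic_nonneg: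
  fixes M :: "real^'n^'n"
  assumes M: "transpose M = M" "pos_def M"
  shows "1/2 * (x \<bullet> (M *v x)) + 1/2 * (y \<bullet> (matrix_inv M *v y)) - x \<bullet> y \<ge> 0"
proof -
  define w where "w = matrix_inv M *v y"
  have y: "y = M *v w" by (simp add: w_def pos_def_matrix_inv_mult[OF M(2)])
  have "0 \<le> (x - w) \<bullet> (M *v (x - w))"
    using M(2) unfolding pos_def_def by (cases "x - w = 0") (auto intro: less_imp_le)
  also have "\<dots> = x \<bullet> (M *v x) + y \<bullet> w - 2 * (x \<bullet> y)"
    using symmetric_inner[OF M(1), of x w]
    by (simp add: y matrix_vector_mult_diff_distrib inner_diff_left inner_diff_right inner_commute)
  finally show ?thesis by (simp add: w_def)
qed

lemma conjugate_quadratic_eq: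
  fixes M :: "real^'n^'n"
  assumes "pos_def M"
  shows "1/2 * (x \<bullet> (M *v x)) + 1/2 * ((M *v x) \<bullet> (matrix_inv M *v (M *v x))) - x \<bullet> (M *v x) = 0"
  by (simp add: pos_def_matrix_inv_mult[OF assms] inner_commute)

text \<open>Cramer's rule exhibits the solution of a linear system as a continuous function of the data.\<close>

lemma continuous_on_matrix_inv_mult:
  fixes M :: "'b::topological_space \<Rightarrow> real^'n^'n"
  assumes M: "continuous_on T M" and x: "continuous_on T x" and pd: "\<And>t. t \<in> T \<Longrightarrow> pos_def (M t)"
  shows "continuous_on T (\<lambda>t. matrix_inv (M t) *v x t)"
proof (rule continuous_on_eq)
  show "continuous_on T (\<lambda>t. \<chi> k. det (\<chi> i j. if j = k then x t $ i else M t $ i $ j) / det (M t))"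
  proof (rule continuous_on_vec_lambda, rule continuous_on_divide)
    have M2: "continuous_on T (\<lambda>t. M t $ i $ j)" for i j
      using M by (intro continuous_on_component)
    then show "continuous_on T (\<lambda>t. det (M t))"
      unfolding det_def
      by (intro continuous_on_sum continuous_on_mult continuous_on_const continuous_on_prod M2)
    show "continuous_on T (\<lambda>t. det (\<chi> i j. if j = k then x t $ i else M t $ i $ j))" for k
      unfolding det_def
    proof (intro continuous_on_sum continuous_on_mult continuous_on_const continuous_on_prod)
      fix p :: "'n \<Rightarrow> 'n" and i :: 'n
      show "continuous_on T (\<lambda>t. (\<chi> i j. if j = k then x t $ i else M t $ i $ j) $ i $ p i)"
        using M2 x by (cases "p i = k") (auto intro!: continuous_on_component)
    qed
    show "\<forall>t\<in>T. det (M t) \<noteq> 0"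
      using pd pos_def_det_nonzero by blast
  qed
  show "(\<chi> k. det (\<chi> i j. if j = k then x t $ i else M t $ i $ j) / det (M t)) = matrix_inv (M t) *v x t"
    if "t \<in> T" for t
    using cramer[of "M t" "matrix_inv (M t) *v x t" "x t"] pos_def_det_nonzero[OF pd[OF that]]
      pos_def_matrix_inv_mult[OF pd[OF that]] by simp
qed

section \<open>Diagonal weights and clipping to an interval\<close>

lemma diagonal_mult_nth:
  fixes M :: "real^'n^'n"
  assumes "diagonal M"
  shows "(M *v x) $ j = M $ j $ j * x $ j"
proof -
  have "(\<Sum>i\<in>UNIV. M $ j $ i * x $ i) = (\<Sum>i\<in>UNIV. if i = j then M $ j $ j * x $ j else 0)"
    using assms by (intro sum.cong) (auto simp: diagonal_def)
  then show ?thesis by (simp add: matrix_vector_mult_def)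
qed

lemma pos_def_diagonal_entry:
  fixes M :: "real^'n^'n"
  assumes "pos_def M"
  shows "M $ j $ j > 0"
proof -
  have "axis j 1 \<bullet> (M *v axis j 1) > 0"
    using assms unfolding pos_def_def by (simp add: axis_eq_0_iff)
  then show ?thesis
    by (simp add: inner_axis' matrix_vector_mul_component inner_axis)
qed

lemma matrix_inv_diagonal_nth:
  fixes M :: "real^'n^'n"
  assumes "diagonal M" "pos_def M"
  shows "(matrix_inv M *v x) $ j = x $ j / M $ j $ j"
  using diagonal_mult_nth[OF assms(1), of "matrix_inv M *v x" j] pos_def_diagonal_entry[OF assms(2), of j]
  by (simp add: pos_def_matrix_inv_mult[OF assms(2)] field_simps)

text \<open>For \<open>a \<le> b\<close> this is the projection onto the interval from
  \<open>a\<close> to \<open>b\<close>. For \<open>a > b\<close> it returns \<open>a\<close>, so the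
  size and Lipschitz bounds hold without ordering the bounds.\<close>

definition clip :: "real \<Rightarrow> real \<Rightarrow> real \<Rightarrow> real" where
  "clip a b w = max a (min b w)"

lemma clip_bounds: "a \<le> b \<Longrightarrow> a \<le> clip a b w \<and> clip a b w \<le> b"
  by (auto simp: clip_def)

lemma abs_clip_le: "\<bar>clip a b w\<bar> \<le> \<bar>a\<bar> + \<bar>b\<bar>"
  by (auto simp: clip_def max_def min_def)

lemma abs_clip_diff_le: "\<bar>clip a b v - clip a b w\<bar> \<le> \<bar>v - w\<bar>"
  by (auto simp: clip_def max_def min_def)

text \<open>The projection \<open>c\<close> of \<open>s / r\<close> satisfies the variational
  inequality \<open>(c - s / r) * (u - c) \<ge> 0\<close>. The difference of the two sides is
  \<open>r\<close> times this product plus \<open>r / 2 * (u - c)\<^sup>2\<close>.\<close>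

lemma clip_maximizes:
  assumes "r > 0" "a \<le> u" "u \<le> b"
  shows "u * s - 1/2 * r * u\<^sup>2 \<le> clip a b (s / r) * s - 1/2 * r * (clip a b (s / r))\<^sup>2"
proof -
  define c where "c = clip a b (s / r)"
  have "(c - s / r) * (u - c) \<ge> 0"
    using assms(2,3) by (auto simp: c_def clip_def max_def min_def zero_le_mult_iff)
  then have "r * ((c - s / r) * (u - c)) \<ge> 0" using assms(1) by simp
  moreover have "r * ((c - s / r) * (u - c)) = (r * c - s) * (u - c)"
    using assms(1) by (simp add: field_simps)
  moreover have "r * (u - c)\<^sup>2 \<ge> 0" using assms(1) by simp
  ultimately show ?thesis
    unfolding c_def[symmetric] by (simp add: power2_eq_square algebra_simps)
qed

text \<open>Identifies the three branches of \<open>theta_j\<close> as one object, the value of the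
  concave function \<open>u * s - 1/2 * r * u\<^sup>2\<close> at its maximiser over the interval:
  the middle branch is the free maximum, the other two are end point values.\<close>

lemma clip_value_cases:
  assumes "r > 0" "a \<le> b"
  shows "(if a \<le> s / r \<and> s / r \<le> b then 1 / (2 * r) * s\<^sup>2
      else if a > s / r then a * s - 1/2 * a\<^sup>2 * r else b * s - 1/2 * b\<^sup>2 * r)
    = clip a b (s / r) * s - 1/2 * (clip a b (s / r) * (r * clip a b (s / r)))"
proof -
  consider "s / r < a" | "a \<le> s / r" "s / r \<le> b" | "s / r > b" by linarith
  then show ?thesis
  proof cases
    case 1
    then have "clip a b (s / r) = a" using assms by (simp add: clip_def)
    with 1 show ?thesis by (simp add: power2_eq_square)
  next
    case 2
    then have "clip a b (s / r) = s / r" by (simp add: clip_def)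
    with 2 show ?thesis using assms(1) by (simp add: power2_eq_square field_simps)
  next
    case 3
    then have "clip a b (s / r) = b" using assms by (simp add: clip_def)
    with 3 show ?thesis using assms by (simp add: power2_eq_square)
  qed
qed

text \<open>A violation at an interior point would persist on a nonempty open set, which is not
  null; the end points follow by closure. It lets one feasible control order the two control bounds
  at every time.\<close>

lemma AE_le_imp_le:
  fixes f g :: "real \<Rightarrow> real"
  assumes f: "continuous_on {0..1} f" and g: "continuous_on {0..1} g"
    and AE: "AE t in leb01. f t \<le> g t" and t: "t \<in> {0..1}"
  shows "f t \<le> g t"
proof -
  obtain N where N: "N \<in> null_sets leb01" "{t \<in> {0..1}. \<not> f t \<le> g t} \<subseteq> N"
    using AE unfolding eventually_ae_filter by auto
  have null: "negligible N"
    using N(1) by (simp add: null_sets_restrict_space negligible_iff_null_sets)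
  have le: "f s \<le> g s" if "s \<in> {0<..<1}" for s
  proof (rule ccontr)
    assume "\<not> f s \<le> g s"
    have "open ({0<..<1} \<inter> (\<lambda>s. g s - f s) -` {..<0})"
      by (rule continuous_open_preimage)
        (auto intro!: continuous_intros continuous_on_subset[OF f] continuous_on_subset[OF g])
    moreover have "s \<in> {0<..<1} \<inter> (\<lambda>s. g s - f s) -` {..<0}"
      using that \<open>\<not> f s \<le> g s\<close> by simp
    moreover have "{0<..<1} \<inter> (\<lambda>s. g s - f s) -` {..<0} \<subseteq> N"
      using N(2) by auto
    ultimately show False
      using open_not_negligible negligible_subset[OF null] by blast
  qed
  have "closure {0<..<1::real} = {0..1}" by simp
  moreover have "f s - g s \<in> {..0}" if "s \<in> closure {0<..<1}" for s
    by (rule image_closure_subset[of "{0<..<1}" "\<lambda>s. f s - g s" "{..0}", THEN subsetD, OF _ _ _ imageI])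
      (use that le f g in \<open>auto intro!: continuous_intros\<close>)
  ultimately show ?thesis using t by force
qed

section \<open>Duality for a fixed parameter\<close>

text \<open>The problem at one fixed parameter. Smoothness is recorded for \<open>Qmat\<close> in
  particular because \<open>\<rho> = Q z\<close> must be differentiated to be placed in
  \<open>W12\<close>.\<close>

locale lq_problem =
  fixes S :: "('m::finite, 'n::finite, 'k::finite) lq_data" and \<epsilon> :: real
  assumes eps_pos: "\<epsilon> > 0"
    and alpha_cont: "continuous_on {0..1} (alpha S)"
    and beta_cont: "continuous_on {0..1} (beta S)"
    and Q_smooth: "smooth01 (\<lambda>t. Qmat S t \<epsilon>)"
    and R_cont: "continuous_on {0..1} (\<lambda>t. Rmat S t \<epsilon>)"
    and A_cont: "continuous_on {0..1} (\<lambda>t. Amat S t \<epsilon>)"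
    and b_cont: "continuous_on {0..1} (\<lambda>t. bmat S t \<epsilon>)"
    and R: "\<And>t. t \<in> {0..1} \<Longrightarrow> diagonal (Rmat S t \<epsilon>)" "\<And>t. t \<in> {0..1} \<Longrightarrow> pos_def (Rmat S t \<epsilon>)"
    and Q: "\<And>t. t \<in> {0..1} \<Longrightarrow> transpose (Qmat S t \<epsilon>) = Qmat S t \<epsilon>"
      "\<And>t. t \<in> {0..1} \<Longrightarrow> pos_def (Qmat S t \<epsilon>)"
    and pi: "transpose (pimat S \<epsilon>) = pimat S \<epsilon>" "pos_def (pimat S \<epsilon>)"
    and feasible: "\<exists>u z. primal_feasible S \<epsilon> u z"
begin

abbreviation "A t \<equiv> Amat S t \<epsilon>"
abbreviation "b t \<equiv> bmat S t \<epsilon>"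
abbreviation "Q t \<equiv> Qmat S t \<epsilon>"
abbreviation "R t \<equiv> Rmat S t \<epsilon>"
abbreviation "I \<equiv> I_eps \<epsilon> :: real^('m + 'n)^('m + 'n)"
abbreviation "J \<equiv> I_eps (1 / \<epsilon>) :: real^('m + 'n)^('m + 'n)"

text \<open>The maximiser of \<open>u \<bullet> (p v* b t) - 1/2 * (u \<bullet> (R t *v u))\<close>
  over the control box: \<open>R\<close> is diagonal, so the maximisation decouples into one
  clipping per coordinate.\<close>

definition ctrl :: "real \<Rightarrow> real^('m + 'n) \<Rightarrow> real^'k" where
  "ctrl t p = (\<chi> j. clip (alpha S t $ j) (beta S t $ j) ((p v* b t) $ j / R t $ j $ j))"

lemma Q_cont: "continuous_on {0..1} Q"
  by (rule smooth01_imp_continuous_on[OF Q_smooth])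

lemma R_entry_pos: "t \<in> {0..1} \<Longrightarrow> R t $ j $ j > 0"
  using pos_def_diagonal_entry[OF R(2)] .

lemma R_entry_cont: "continuous_on {0..1} (\<lambda>t. R t $ j $ j)"
  by (intro continuous_on_component R_cont)

lemma alpha_le_beta:
  assumes "t \<in> {0..1}"
  shows "alpha S t $ j \<le> beta S t $ j"
proof (rule AE_le_imp_le[OF _ _ _ assms])
  obtain u z where "primal_feasible S \<epsilon> u z" using feasible by blast
  then have "AE t in leb01. \<forall>j. alpha S t $ j \<le> u t $ j \<and> u t $ j \<le> beta S t $ j"
    by (simp add: primal_feasible_def controls_def)
  then show "AE t in leb01. alpha S t $ j \<le> beta S t $ j"
    by eventually_elim (meson order_trans)
qed (intro continuous_on_component alpha_cont beta_cont)+

text \<open>Shows that \<open>theta\<close> is the conjugate of the box-constrained control cost,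
  evaluated at \<open>p v* b t\<close> with \<open>p = I *v \<gamma>\<close> and written through its
  maximiser.\<close>

lemma theta_eq:
  assumes t: "t \<in> {0..1}"
  shows "theta S t \<epsilon> \<gamma> = ctrl t (I *v \<gamma>) \<bullet> ((I *v \<gamma>) v* b t)
    - 1/2 * (ctrl t (I *v \<gamma>) \<bullet> (R t *v ctrl t (I *v \<gamma>)))"
proof -
  define s where "s = (I *v \<gamma>) v* b t"
  define c where "c = ctrl t (I *v \<gamma>)"
  have c: "c $ j = clip (alpha S t $ j) (beta S t $ j) (s $ j / R t $ j $ j)" for j
    by (simp add: c_def ctrl_def s_def)
  have w: "((matrix_inv (R t) ** transpose (b t) ** I) *v \<gamma>) $ j = s $ j / R t $ j $ j" for j
    using matrix_inv_diagonal_nth[OF R(1,2), OF t t, of s j]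
    by (simp add: s_def flip: matrix_vector_mul_assoc)
  have "theta_j S t \<epsilon> \<gamma> j = c $ j * s $ j - 1/2 * (c $ j * (R t $ j $ j * c $ j))" for j
    unfolding theta_j_def Let_def w c vector_matrix_mult_I_eps s_def[symmetric]
    by (rule clip_value_cases[OF R_entry_pos[OF t] alpha_le_beta[OF t]])
  then show ?thesis
    unfolding theta_def c_def[symmetric] s_def[symmetric]
    by (simp add: inner_vec_def diagonal_mult_nth[OF R(1)[OF t]] sum_subtractf flip: sum_divide_distrib)
qed

text \<open>The time is a function \<open>\<tau>\<close> of the point so that the lemma covers
  trajectories as well as joint continuity in time and adjoint, where \<open>\<tau>\<close> is a
  projection.\<close>

lemma ctrl_cont:
  assumes "continuous_on T p" "continuous_on T \<tau>" "\<tau> ` T \<subseteq> {0..1}"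
  shows "continuous_on T (\<lambda>x. ctrl (\<tau> x) (p x))"
proof -
  have c: "continuous_on T (\<lambda>x. f (\<tau> x))" if "continuous_on {0..1} f" for f :: "real \<Rightarrow> 'b::topological_space"
    using continuous_on_compose2[OF that assms(2,3)] .
  have "continuous_on T (\<lambda>x. (p x v* b (\<tau> x)) $ j / R (\<tau> x) $ j $ j)" for j
    using R_entry_pos assms(3)
    by (intro continuous_on_divide continuous_on_component continuous_on_vector_matrix_mult
        c[OF b_cont] c[OF R_cont] assms(1)) (force simp: less_le)
  then show ?thesis
    unfolding ctrl_def clip_def
    by (intro continuous_on_vec_lambda continuous_on_max continuous_on_min continuous_on_component
        c[OF alpha_cont] c[OF beta_cont])
qed

lemma theta_cont:
  assumes "continuous_on {0..1} \<gamma>"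
  shows "continuous_on {0..1} (\<lambda>t. theta S t \<epsilon> (\<gamma> t))"
proof (rule continuous_on_eq)
  have *: "continuous_on {0..1} (\<lambda>t. I *v \<gamma> t)"
    by (intro continuous_intros assms)
  show "continuous_on {0..1} (\<lambda>t. ctrl t (I *v \<gamma> t) \<bullet> ((I *v \<gamma> t) v* b t)
    - 1/2 * (ctrl t (I *v \<gamma> t) \<bullet> (R t *v ctrl t (I *v \<gamma> t))))"
    by (intro continuous_intros ctrl_cont * b_cont R_cont) auto
qed (simp add: theta_eq)

text \<open>Controls are only square integrable, so continuity is no help: the quadratic term is
  dominated coordinatewise through bounded diagonal entries, the linear one by Young's inequality
  against the constant \<open>B\<^sup>2\<close>.\<close>

lemma control_integrable:
  assumes u: "u \<in> L2" and s: "continuous_on {0..1} s"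
  shows "integrable leb01 (\<lambda>t. u t \<bullet> (R t *v u t))" "integrable leb01 (\<lambda>t. u t \<bullet> s t)"
proof -
  have um: "u \<in> borel_measurable leb01" and u2: "integrable leb01 (\<lambda>t. (norm (u t))\<^sup>2)"
    using u by (auto simp: L2_def)
  have cm: "f \<in> borel_measurable leb01" if "continuous_on {0..1} f" for f :: "real \<Rightarrow> 'b::euclidean_space"
    using that by (intro continuous_imp_measurable_on_sets_lebesgue) auto
  have uj: "(\<lambda>t. u t $ j) \<in> borel_measurable leb01" for j
    using um by (rule measurable_compose)
      (auto intro!: borel_measurable_continuous_onI continuous_intros)
  have b: "\<exists>B. \<forall>t\<in>{0..1}. norm (f t) \<le> B" if "continuous_on {0..1} f" for f :: "real \<Rightarrow> 'b::euclidean_space"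
    using compact_imp_bounded[OF compact_continuous_image[OF that]] unfolding bounded_iff by auto
  have "integrable leb01 (\<lambda>t. R t $ j $ j * (u t $ j)\<^sup>2)" for j
  proof -
    obtain B where B: "\<forall>t\<in>{0..1}. norm (R t $ j $ j) \<le> B"
      using b[OF R_entry_cont] by blast
    show ?thesis
    proof (rule Bochner_Integration.integrable_bound)
      show "integrable leb01 (\<lambda>t. B * (norm (u t))\<^sup>2)" using u2 by simp
      show "AE t in leb01. norm (R t $ j $ j * (u t $ j)\<^sup>2) \<le> norm (B * (norm (u t))\<^sup>2)"
      proof (rule AE_I2)
        fix t assume "t \<in> space leb01"
        then have "\<bar>R t $ j $ j\<bar> \<le> B" using B by simp
        moreover have "(u t $ j)\<^sup>2 \<le> (norm (u t))\<^sup>2"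
          using component_le_norm_cart[of "u t" j] by (metis abs_ge_zero power2_abs power_mono)
        ultimately have "\<bar>R t $ j $ j\<bar> * (u t $ j)\<^sup>2 \<le> B * (norm (u t))\<^sup>2"
          by (intro mult_mono) auto
        also have "\<dots> \<le> norm (B * (norm (u t))\<^sup>2)"
          unfolding real_norm_def by (rule abs_ge_self)
        finally show "norm (R t $ j $ j * (u t $ j)\<^sup>2) \<le> norm (B * (norm (u t))\<^sup>2)"
          by (simp add: abs_mult)
      qed
      show "(\<lambda>t. R t $ j $ j * (u t $ j)\<^sup>2) \<in> borel_measurable leb01"
        using uj cm[OF R_entry_cont] by simp
    qed
  qed
  then have "integrable leb01 (\<lambda>t. \<Sum>j\<in>UNIV. R t $ j $ j * (u t $ j)\<^sup>2)" by simp
  moreover have "(\<Sum>j\<in>UNIV. R t $ j $ j * (u t $ j)\<^sup>2) = u t \<bullet> (R t *v u t)" if "t \<in> {0..1}" for t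
    by (simp add: inner_vec_def diagonal_mult_nth[OF R(1)[OF that]] power2_eq_square mult_ac)
  ultimately show "integrable leb01 (\<lambda>t. u t \<bullet> (R t *v u t))"
    using Bochner_Integration.integrable_cong[of leb01 leb01 "\<lambda>t. \<Sum>j\<in>UNIV. R t $ j $ j * (u t $ j)\<^sup>2"
        "\<lambda>t. u t \<bullet> (R t *v u t)"] by simp
  obtain B where B: "\<forall>t\<in>{0..1}. norm (s t) \<le> B"
    using b[OF s] by blast
  show "integrable leb01 (\<lambda>t. u t \<bullet> s t)"
  proof (rule Bochner_Integration.integrable_bound)
    show "integrable leb01 (\<lambda>t. (norm (u t))\<^sup>2 + B\<^sup>2)"
      by (intro Bochner_Integration.integrable_add u2 continuous_imp_integrable_real continuous_on_const)
    show "AE t in leb01. norm (u t \<bullet> s t) \<le> norm ((norm (u t))\<^sup>2 + B\<^sup>2)"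
    proof (rule AE_I2)
      fix t assume "t \<in> space leb01"
      then have "norm (s t) \<le> B" using B by simp
      then have "norm (u t) * norm (s t) \<le> norm (u t) * B"
        by (intro mult_left_mono) auto
      moreover have "2 * norm (u t) * B \<le> (norm (u t))\<^sup>2 + B\<^sup>2" by (rule sum_squares_bound)
      moreover have "0 \<le> norm (u t) * norm (s t)" by simp
      ultimately have "norm (u t \<bullet> s t) \<le> (norm (u t))\<^sup>2 + B\<^sup>2"
        using Cauchy_Schwarz_ineq2[of "u t" "s t"] unfolding real_norm_def by linarith
      also have "\<dots> \<le> norm ((norm (u t))\<^sup>2 + B\<^sup>2)"
        unfolding real_norm_def by (rule abs_ge_self)
      finally show "norm (u t \<bullet> s t) \<le> norm ((norm (u t))\<^sup>2 + B\<^sup>2)" .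
    qed
    show "(\<lambda>t. u t \<bullet> s t) \<in> borel_measurable leb01"
      using um cm[OF s] by simp
  qed
qed

section \<open>The duality gap and weak duality\<close>

definition state_gap :: "(real \<Rightarrow> real^('m + 'n)) \<Rightarrow> (real \<Rightarrow> real^('m + 'n)) \<Rightarrow> real \<Rightarrow> real" where
  "state_gap z \<rho> t = 1/2 * (z t \<bullet> (Q t *v z t)) + 1/2 * (\<rho> t \<bullet> (matrix_inv (Q t) *v \<rho> t)) - z t \<bullet> \<rho> t"

definition control_gap :: "(real \<Rightarrow> real^'k) \<Rightarrow> (real \<Rightarrow> real^('m + 'n)) \<Rightarrow> real \<Rightarrow> real" where
  "control_gap u \<gamma> t = 1/2 * (u t \<bullet> (R t *v u t)) + theta S t \<epsilon> (\<gamma> t) - u t \<bullet> ((I *v \<gamma> t) v* b t)"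

text \<open>The plus sign before \<open>x \<bullet> q\<close> makes this the Fenchel-Young defect at
  \<open>- x\<close>, matching the transversality condition
  \<open>q = - (pimat S \<epsilon> *v x)\<close>.\<close>

definition terminal_gap :: "real^('m + 'n) \<Rightarrow> real^('m + 'n) \<Rightarrow> real" where
  "terminal_gap x q = 1/2 * (x \<bullet> (pimat S \<epsilon> *v x)) + 1/2 * (q \<bullet> (matrix_inv (pimat S \<epsilon>) *v q)) + x \<bullet> q"

text \<open>In the derivative of \<open>z \<bullet> (I *v \<gamma>)\<close> the terms with
  \<open>A\<close> cancel because the two dynamics are adjoint, leaving
  \<open>u \<bullet> s + z \<bullet> \<rho>\<close>. The boundary value at 0 cancels the linear term
  in \<open>\<gamma> 0\<close> of the dual functional; the one at 1 becomes the mixed term of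
  \<open>terminal_gap\<close>.\<close>

lemma duality_gap:
  assumes p: "primal_feasible S \<epsilon> u z" and d: "dual_feasible S \<epsilon> \<gamma> \<rho>"
  shows "J_primal S \<epsilon> u z - J_dual S \<epsilon> \<gamma> \<rho> =
    (\<integral>t. state_gap z \<rho> t + control_gap u \<gamma> t \<partial>leb01) + terminal_gap (z 1) (I *v \<gamma> 1)"
proof -
  have u: "u \<in> L2" and z: "z \<in> W12" "z 0 = z0 S"
    and zd: "AE t in leb01. I *v ddt z t = A t *v z t + (I ** b t) *v u t"
    using p by (auto simp: primal_feasible_def controls_def)
  have g: "\<gamma> \<in> W12" and r: "\<rho> \<in> W12"
    and gd: "AE t in leb01. I *v ddt \<gamma> t = - (transpose (A t) *v \<gamma> t) + \<rho> t"
    using d by (auto simp: dual_feasible_def)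
  note cont = W12_continuous[OF z(1)] W12_continuous[OF g] W12_continuous[OF r]
  define s where "s t = (I *v \<gamma> t) v* b t" for t
  have s: "continuous_on {0..1} s"
    unfolding s_def by (intro continuous_intros cont b_cont)
  note u_int = control_integrable[OF u s]
  have int: "integrable leb01 (\<lambda>t. z t \<bullet> (Q t *v z t))" "integrable leb01 (\<lambda>t. z t \<bullet> \<rho> t)"
    "integrable leb01 (\<lambda>t. \<rho> t \<bullet> (matrix_inv (Q t) *v \<rho> t))" "integrable leb01 (\<lambda>t. theta S t \<epsilon> (\<gamma> t))"
    by (intro continuous_imp_integrable_real continuous_intros cont Q_cont theta_cont
        continuous_on_matrix_inv_mult Q; assumption)+
  have ac: "abs_cont01 (\<lambda>t. z t \<bullet> (I *v \<gamma> t))"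
  proof -
    obtain K where K: "K > 0" "\<And>x. norm (I *v x) \<le> norm x * K"
      using bounded_linear.pos_bounded[OF matrix_vector_mul_bounded_linear, of I] by blast
    have "abs_cont01 (\<lambda>t. I *v \<gamma> t)"
    proof (rule abs_cont01_bound[where f = \<gamma> and g = \<gamma>, OF _ _ K(1)])
      show "norm (I *v \<gamma> s - I *v \<gamma> t) \<le> K * (norm (\<gamma> s - \<gamma> t) + norm (\<gamma> s - \<gamma> t))" for s t
      proof -
        have "norm (I *v \<gamma> s - I *v \<gamma> t) \<le> K * norm (\<gamma> s - \<gamma> t)"
          using K(2)[of "\<gamma> s - \<gamma> t"] by (simp add: matrix_vector_mult_diff_distrib mult.commute)
        also have "\<dots> \<le> K * (norm (\<gamma> s - \<gamma> t) + norm (\<gamma> s - \<gamma> t))"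
          using K(1) by (intro mult_left_mono) auto
        finally show ?thesis .
      qed
    qed (use g in \<open>auto simp: W12_def\<close>)
    then show ?thesis using z(1) by (intro abs_cont01_inner) (auto simp: W12_def)
  qed
  have "AE t in leb01. ((\<lambda>t. z t \<bullet> (I *v \<gamma> t)) has_vector_derivative (u t \<bullet> s t + z t \<bullet> \<rho> t))
      (at t within {0..1})"
    using zd gd W12_derivative[OF z(1)] W12_derivative[OF g]
  proof eventually_elim
    fix t
    assume eqs: "I *v ddt z t = A t *v z t + (I ** b t) *v u t"
        "I *v ddt \<gamma> t = - (transpose (A t) *v \<gamma> t) + \<rho> t"
      and ders: "(z has_vector_derivative ddt z t) (at t within {0..1})"
        "(\<gamma> has_vector_derivative ddt \<gamma> t) (at t within {0..1})"
    have "((\<lambda>t. z t \<bullet> (I *v \<gamma> t)) has_vector_derivative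
        (z t \<bullet> (I *v ddt \<gamma> t) + ddt z t \<bullet> (I *v \<gamma> t))) (at t within {0..1})"
      by (intro bounded_bilinear.has_vector_derivative[OF bounded_bilinear_inner] ders
          bounded_linear.has_vector_derivative[OF matrix_vector_mul_bounded_linear])
    also have "z t \<bullet> (I *v ddt \<gamma> t) + ddt z t \<bullet> (I *v \<gamma> t)
        = z t \<bullet> (I *v ddt \<gamma> t) + (I *v ddt z t) \<bullet> \<gamma> t"
      by (simp add: inner_I_eps)
    also have "\<dots> = u t \<bullet> s t + z t \<bullet> \<rho> t"
    proof -
      have "z t \<bullet> (\<gamma> t v* A t) = (A t *v z t) \<bullet> \<gamma> t"
        by (metis dot_lmul_matrix inner_commute)
      moreover have "((I ** b t) *v u t) \<bullet> \<gamma> t = u t \<bullet> s t"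
        by (metis s_def dot_lmul_matrix inner_I_eps inner_commute matrix_vector_mul_assoc)
      ultimately show ?thesis
        unfolding eqs by (simp add: inner_add_left inner_add_right inner_diff_right)
    qed
    finally show "((\<lambda>t. z t \<bullet> (I *v \<gamma> t)) has_vector_derivative (u t \<bullet> s t + z t \<bullet> \<rho> t))
      (at t within {0..1})" .
  qed
  from abs_cont01_has_integral_derivative[OF ac this]
  have ftc: "((\<lambda>t. u t \<bullet> s t + z t \<bullet> \<rho> t) has_integral (z 1 \<bullet> (I *v \<gamma> 1) - z 0 \<bullet> (I *v \<gamma> 0))) {0..1}" .
  \<comment> \<open>The fundamental theorem yields a gauge integral, while the functionals use the
    Lebesgue integral; integrability identifies the two.\<close>
  have "((\<lambda>t. u t \<bullet> s t + z t \<bullet> \<rho> t) has_integral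
      (\<integral>t. u t \<bullet> s t + z t \<bullet> \<rho> t \<partial>leb01)) {0..1}"
    using u_int(2) int(2) by (intro has_integral_integral_lebesgue_on) auto
  then have parts: "(\<integral>t. u t \<bullet> s t + z t \<bullet> \<rho> t \<partial>leb01) = z 1 \<bullet> (I *v \<gamma> 1) - z0 S \<bullet> (I *v \<gamma> 0)"
    using has_integral_unique[OF _ ftc] z(2) by simp
  have "(\<integral>t. state_gap z \<rho> t + control_gap u \<gamma> t \<partial>leb01) =
      (\<integral>t. 1/2 * (z t \<bullet> (Q t *v z t) + u t \<bullet> (R t *v u t))
        - (- 1/2 * (\<rho> t \<bullet> (matrix_inv (Q t) *v \<rho> t)) - theta S t \<epsilon> (\<gamma> t))
        - (u t \<bullet> s t + z t \<bullet> \<rho> t) \<partial>leb01)"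
    by (simp add: state_gap_def control_gap_def s_def algebra_simps)
  also have "\<dots> = 1/2 * (\<integral>t. (z t \<bullet> (Q t *v z t) + u t \<bullet> (R t *v u t)) \<partial>leb01)
      - (\<integral>t. (- 1/2 * (\<rho> t \<bullet> (matrix_inv (Q t) *v \<rho> t)) - theta S t \<epsilon> (\<gamma> t)) \<partial>leb01)
      - (\<integral>t. (u t \<bullet> s t + z t \<bullet> \<rho> t) \<partial>leb01)"
  proof -
    have "integrable leb01 (\<lambda>t. 1/2 * (z t \<bullet> (Q t *v z t) + u t \<bullet> (R t *v u t)))"
      "integrable leb01 (\<lambda>t. - 1/2 * (\<rho> t \<bullet> (matrix_inv (Q t) *v \<rho> t)) - theta S t \<epsilon> (\<gamma> t))"
      "integrable leb01 (\<lambda>t. u t \<bullet> s t + z t \<bullet> \<rho> t)"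
      by (intro Bochner_Integration.integrable_add Bochner_Integration.integrable_diff
          integrable_mult_right int u_int)+
    then show ?thesis
      by (simp only: Bochner_Integration.integral_diff Bochner_Integration.integrable_diff
          integral_mult_right_zero)
  qed
  finally have "(\<integral>t. state_gap z \<rho> t + control_gap u \<gamma> t \<partial>leb01) = \<dots>" .
  moreover have "\<gamma> 1 \<bullet> ((I ** matrix_inv (pimat S \<epsilon>) ** I) *v \<gamma> 1)
      = (I *v \<gamma> 1) \<bullet> (matrix_inv (pimat S \<epsilon>) *v (I *v \<gamma> 1))"
    by (simp add: inner_I_eps flip: matrix_vector_mul_assoc)
  moreover have "\<gamma> 0 \<bullet> (I *v z0 S) = z0 S \<bullet> (I *v \<gamma> 0)"
    by (metis inner_I_eps inner_commute)
  ultimately show ?thesis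
    unfolding J_primal_def J_dual_def terminal_gap_def parts by simp
qed

text \<open>The state and control defects are nonnegative almost everywhere, the latter since an
  admissible control competes coordinatewise with the maximiser \<open>ctrl\<close>.\<close>

lemma weak_duality:
  assumes p: "primal_feasible S \<epsilon> u z" and d: "dual_feasible S \<epsilon> \<gamma> \<rho>"
  shows "J_dual S \<epsilon> \<gamma> \<rho> \<le> J_primal S \<epsilon> u z"
proof -
  have adm: "AE t in leb01. \<forall>j. alpha S t $ j \<le> u t $ j \<and> u t $ j \<le> beta S t $ j"
    using p by (auto simp: primal_feasible_def controls_def)
  have "AE t in leb01. 0 \<le> state_gap z \<rho> t + control_gap u \<gamma> t"
    using adm AE_space
  proof eventually_elim
    fix t assume u: "\<forall>j. alpha S t $ j \<le> u t $ j \<and> u t $ j \<le> beta S t $ j" and "t \<in> space leb01"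
    then have t: "t \<in> {0..1}" by simp
    define s where "s = (I *v \<gamma> t) v* b t"
    define c where "c = ctrl t (I *v \<gamma> t)"
    have RR: "x \<bullet> y - 1/2 * (x \<bullet> (R t *v x)) = (\<Sum>j\<in>UNIV. x $ j * y $ j - 1/2 * R t $ j $ j * (x $ j)\<^sup>2)" for x y
      by (simp add: inner_vec_def diagonal_mult_nth[OF R(1)[OF t]] sum_subtractf sum_distrib_left
          power2_eq_square mult_ac)
    have "u t \<bullet> s - 1/2 * (u t \<bullet> (R t *v u t)) \<le> c \<bullet> s - 1/2 * (c \<bullet> (R t *v c))"
      unfolding RR using clip_maximizes[OF R_entry_pos[OF t]] u
      by (intro sum_mono) (simp add: c_def ctrl_def s_def)
    then have "0 \<le> control_gap u \<gamma> t"
      by (simp add: control_gap_def theta_eq[OF t] c_def s_def)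
    moreover have "0 \<le> state_gap z \<rho> t"
      unfolding state_gap_def by (rule conjugate_quadratic_nonneg[OF Q[OF t]])
    ultimately show "0 \<le> state_gap z \<rho> t + control_gap u \<gamma> t" by simp
  qed
  then have "0 \<le> (\<integral>t. state_gap z \<rho> t + control_gap u \<gamma> t \<partial>leb01)"
    by (rule integral_nonneg_AE)
  moreover have "0 \<le> terminal_gap (z 1) (I *v \<gamma> 1)"
    using conjugate_quadratic_nonneg[OF pi, of "- z 1" "I *v \<gamma> 1"]
    by (simp add: terminal_gap_def vec.neg)
  ultimately show ?thesis
    using duality_gap[OF p d] by linarith
qed

text \<open>The Pontryagin system in \<open>z\<close> and \<open>p = I *v \<gamma>\<close>.
  Multiplying the state equation by \<open>J\<close>, the inverse of \<open>I\<close>, removes the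
  scaling and leaves \<open>b\<close> unscaled; substituting \<open>\<gamma> = J *v p\<close> and
  \<open>\<rho> = Q z\<close> turns the dual constraint into the equation for
  \<open>p\<close>.\<close>

lemma extremal_exists:
  obtains z p where "z 0 = z0 S" "p 1 = - (pimat S \<epsilon> *v z 1)"
    "\<And>t. t \<in> {0..1} \<Longrightarrow>
      (z has_vector_derivative J *v (A t *v z t) + b t *v ctrl t (p t)) (at t within {0..1})"
    "\<And>t. t \<in> {0..1} \<Longrightarrow>
      (p has_vector_derivative Q t *v z t - (J *v p t) v* A t) (at t within {0..1})"
proof -
  note extremal = that
  note bb = bounded_bilinear_matrix_vector_mult and bb' = bounded_bilinear_vector_matrix_mult
  obtain KA where KA: "KA \<ge> 0" "\<And>t x. t \<in> {0..1} \<Longrightarrow> norm (A t *v x) \<le> KA * norm x"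
    using bounded_bilinear_uniform_bound[OF bb A_cont] by blast
  obtain KA' where KA': "KA' \<ge> 0" "\<And>t x. t \<in> {0..1} \<Longrightarrow> norm (x v* A t) \<le> KA' * norm x"
    using bounded_bilinear_uniform_bound[OF bb' A_cont] by blast
  obtain KQ where KQ: "KQ \<ge> 0" "\<And>t x. t \<in> {0..1} \<Longrightarrow> norm (Q t *v x) \<le> KQ * norm x"
    using bounded_bilinear_uniform_bound[OF bb Q_cont] by blast
  obtain Kb where Kb: "Kb \<ge> 0" "\<And>t x. t \<in> {0..1} \<Longrightarrow> norm (b t *v x) \<le> Kb * norm x"
    using bounded_bilinear_uniform_bound[OF bb b_cont] by blast
  obtain KJ where KJ: "KJ \<ge> 0" "\<And>x. norm (J *v x) \<le> norm x * KJ"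
    using bounded_linear.nonneg_bounded[OF matrix_vector_mul_bounded_linear, of J] by blast
  obtain Kp where Kp: "Kp \<ge> 0" "\<And>x. norm (pimat S \<epsilon> *v x) \<le> norm x * Kp"
    using bounded_linear.nonneg_bounded[OF matrix_vector_mul_bounded_linear, of "pimat S \<epsilon>"] by blast
  \<comment> \<open>This is \<open>b\<close> times the inverse of the diagonal matrix
    \<open>R\<close>. The argument of the clipping is then linear in \<open>p\<close>, and
    nonexpansiveness of \<open>clip\<close> yields the Lipschitz constant \<open>KN\<close>.\<close>
  define N :: "real \<Rightarrow> real^('k)^('m + 'n)" where "N t = (\<chi> i j. b t $ i $ j / R t $ j $ j)" for t
  have N: "(x v* b t) $ j / R t $ j $ j = (x v* N t) $ j" for t x j
    by (simp add: vector_matrix_mult_def N_def sum_divide_distrib)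
  have N_cont: "continuous_on {0..1} N"
    unfolding N_def
  proof (intro continuous_on_vec_lambda continuous_on_divide)
    show "\<forall>t\<in>{0..1}. R t $ j $ j \<noteq> 0" for j
      using R_entry_pos by (metis less_irrefl)
  qed (intro continuous_on_component b_cont R_cont)+
  obtain KN where KN: "KN \<ge> 0" "\<And>t x. t \<in> {0..1} \<Longrightarrow> norm (x v* N t) \<le> KN * norm x"
    using bounded_bilinear_uniform_bound[OF bb' N_cont] by blast
  have ctrl_lip: "norm (ctrl t x - ctrl t y) \<le> KN * norm (x - y)" if t: "t \<in> {0..1}" for t x y
  proof -
    have "norm (ctrl t x - ctrl t y) \<le> norm ((x - y) v* N t)"
    proof (rule norm_le_componentwise_cart)
      show "norm ((ctrl t x - ctrl t y) $ j) \<le> norm (((x - y) v* N t) $ j)" for j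
        using abs_clip_diff_le by (simp add: ctrl_def N bounded_bilinear.diff_right[OF bb'])
    qed
    also have "\<dots> \<le> KN * norm (x - y)" by (rule KN(2)[OF t])
    finally show ?thesis .
  qed
  have "continuous_on {0..1} (\<lambda>t. \<chi> j. \<bar>alpha S t $ j\<bar> + \<bar>beta S t $ j\<bar>)"
    by (intro continuous_intros alpha_cont beta_cont)
  from compact_imp_bounded[OF compact_continuous_image[OF this compact_Icc]]
  obtain Kc where Kc: "\<And>t. t \<in> {0..1} \<Longrightarrow> norm (\<chi> j. \<bar>alpha S t $ j\<bar> + \<bar>beta S t $ j\<bar>) \<le> Kc"
    unfolding bounded_iff by blast
  have ctrl_bound: "norm (ctrl t x) \<le> Kc" if t: "t \<in> {0..1}" for t x
  proof -
    have "norm (ctrl t x) \<le> norm (\<chi> j. \<bar>alpha S t $ j\<bar> + \<bar>beta S t $ j\<bar>)"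
      by (rule norm_le_componentwise_cart) (use abs_clip_le in \<open>simp add: ctrl_def\<close>)
    also have "\<dots> \<le> Kc" by (rule Kc[OF t])
    finally show ?thesis .
  qed
  have c: "continuous_on ({0..1} \<times> T) (\<lambda>x. f (fst x))" if "continuous_on {0..1} f"
    for f :: "real \<Rightarrow> 'b::topological_space" and T :: "'c::topological_space set"
    by (rule continuous_on_compose2[OF that]) (auto intro!: continuous_intros)
  \<comment> \<open>One constant above the four needed: \<open>KA * KJ\<close> for the linear part,
    \<open>Kb * KN\<close> for the control, \<open>KQ + KA' * KJ\<close> for the adjoint and
    \<open>Kp\<close> for the terminal map.\<close>
  define L where "L = KA * KJ + Kb * KN + (KQ + KA' * KJ) + Kp"
  have L_parts: "KA * KJ \<ge> 0" "Kb * KN \<ge> 0" "KA' * KJ \<ge> 0"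
    using KA KJ Kb KN KA' by auto
  have L_ge: "KA * KJ \<le> L" "Kb * KN \<le> L" "KQ + KA' * KJ \<le> L" "Kp \<le> L" "0 \<le> L"
    using L_parts KQ(1) Kp(1) by (auto simp: L_def)
  have le_L: "n \<le> k * x \<Longrightarrow> k \<le> L \<Longrightarrow> 0 \<le> x \<Longrightarrow> n \<le> L * x" for n k x
    by (meson mult_right_mono order_trans)
  show ?thesis
  proof (rule two_point_boundary_value_problem[where A = "\<lambda>t x. J *v (A t *v x)"
        and g = "\<lambda>t p. b t *v ctrl t p" and h = "\<lambda>t x. Q t *v fst x - (J *v snd x) v* A t"
        and P = "\<lambda>x. - (pimat S \<epsilon> *v x)" and L = L and C = "Kb * Kc" and c = "z0 S"])
    show "linear (\<lambda>x. J *v (A t *v x))" for t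
      by (simp add: matrix_vector_mul_assoc)
    show "continuous_on ({0..1} \<times> UNIV) (\<lambda>(t, x). J *v (A t *v x))"
      unfolding case_prod_beta by (intro continuous_intros c[OF A_cont])
    show "continuous_on ({0..1} \<times> UNIV) (\<lambda>(t, p). b t *v ctrl t p)"
      unfolding case_prod_beta by (intro continuous_intros c[OF b_cont] ctrl_cont) auto
    show "continuous_on ({0..1} \<times> UNIV) (\<lambda>(t, x). Q t *v fst x - (J *v snd x) v* A t)"
      unfolding case_prod_beta by (intro continuous_intros c[OF A_cont] c[OF Q_cont])
    show "norm (J *v (A t *v x)) \<le> L * norm x" if t: "t \<in> {0..1}" for t x
    proof (rule le_L[OF _ L_ge(1)])
      show "norm (J *v (A t *v x)) \<le> KA * KJ * norm x"
        using KJ(2)[of "A t *v x"] mult_right_mono[OF KA(2)[OF t, of x] KJ(1)] by (simp add: mult_ac)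
    qed simp
    show "norm (b t *v ctrl t x - b t *v ctrl t y) \<le> L * norm (x - y)" if t: "t \<in> {0..1}" for t x y
    proof (rule le_L[OF _ L_ge(2)])
      show "norm (b t *v ctrl t x - b t *v ctrl t y) \<le> Kb * KN * norm (x - y)"
        using Kb(2)[OF t, of "ctrl t x - ctrl t y"] mult_left_mono[OF ctrl_lip[OF t, of x y] Kb(1)]
        by (simp add: matrix_vector_mult_diff_distrib mult_ac)
    qed simp
    show "norm (Q t *v fst x - (J *v snd x) v* A t - (Q t *v fst y - (J *v snd y) v* A t)) \<le> L * norm (x - y)"
      if t: "t \<in> {0..1}" for t and x y :: "(real^('m + 'n)) \<times> (real^('m + 'n))"
    proof (rule le_L[OF _ L_ge(3)])
      have "Q t *v fst x - (J *v snd x) v* A t - (Q t *v fst y - (J *v snd y) v* A t)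
          = Q t *v fst (x - y) - (J *v snd (x - y)) v* A t"
        by (simp add: matrix_vector_mult_diff_distrib bounded_bilinear.diff_right[OF bb'])
      also have "norm \<dots> \<le> norm (Q t *v fst (x - y)) + norm ((J *v snd (x - y)) v* A t)"
        by (rule norm_triangle_ineq4)
      also have "\<dots> \<le> KQ * norm (x - y) + KA' * (norm (x - y) * KJ)"
      proof (rule add_mono)
        have "norm (fst (x - y)) \<le> norm (x - y)" by (metis norm_fst_le prod.collapse)
        then show "norm (Q t *v fst (x - y)) \<le> KQ * norm (x - y)"
          using KQ(2)[OF t, of "fst (x - y)"] mult_left_mono[OF _ KQ(1)] order_trans by blast
        have "norm (J *v snd (x - y)) \<le> norm (snd (x - y)) * KJ" by (rule KJ(2))
        also have "\<dots> \<le> norm (x - y) * KJ"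
          using KJ(1) by (intro mult_right_mono) (metis norm_snd_le prod.collapse)
        finally show "norm ((J *v snd (x - y)) v* A t) \<le> KA' * (norm (x - y) * KJ)"
          using KA'(2)[OF t, of "J *v snd (x - y)"] mult_left_mono[OF _ KA'(1)] order_trans by blast
      qed
      finally show "norm (Q t *v fst x - (J *v snd x) v* A t - (Q t *v fst y - (J *v snd y) v* A t))
          \<le> (KQ + KA' * KJ) * norm (x - y)" by (simp add: algebra_simps)
    qed simp
    show "norm (- (pimat S \<epsilon> *v x) - - (pimat S \<epsilon> *v y)) \<le> L * norm (x - y)" for x y
    proof (rule le_L[OF _ L_ge(4)])
      show "norm (- (pimat S \<epsilon> *v x) - - (pimat S \<epsilon> *v y)) \<le> Kp * norm (x - y)"
        using Kp(2)[of "x - y"] by (simp add: matrix_vector_mult_diff_distrib norm_minus_commute mult.commute)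
    qed simp
    show "norm (b t *v ctrl t x) \<le> Kb * Kc" if t: "t \<in> {0..1}" for t x
      using Kb(2)[OF t, of "ctrl t x"] mult_left_mono[OF ctrl_bound[OF t, of x] Kb(1)] by linarith
    show "0 \<le> L" by (rule L_ge)
    show thesis if "z 0 = z0 S" "p 1 = - (pimat S \<epsilon> *v z 1)"
      "\<And>t. t \<in> {0..1} \<Longrightarrow>
        (z has_vector_derivative J *v (A t *v z t) + b t *v ctrl t (p t)) (at t within {0..1})"
      "\<And>t. t \<in> {0..1} \<Longrightarrow>
        (p has_vector_derivative Q t *v fst (z t, p t) - (J *v snd (z t, p t)) v* A t) (at t within {0..1})"
      for z p
      by (rule extremal[of z p]) (use that in auto)
  qed
qed

text \<open>The extremal is split into a primal pair and a dual pair. Every inequality behind weak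
  duality is then an equality, so the gap formula evaluates to zero.\<close>

lemma strong_duality:
  obtains u z \<gamma> \<rho> where "primal_feasible S \<epsilon> u z" "dual_feasible S \<epsilon> \<gamma> \<rho>"
    "J_primal S \<epsilon> u z = J_dual S \<epsilon> \<gamma> \<rho>"
proof -
  obtain z p where z0: "z 0 = z0 S" and p1: "p 1 = - (pimat S \<epsilon> *v z 1)"
    and z: "\<And>t. t \<in> {0..1} \<Longrightarrow>
      (z has_vector_derivative J *v (A t *v z t) + b t *v ctrl t (p t)) (at t within {0..1})"
    and p: "\<And>t. t \<in> {0..1} \<Longrightarrow>
      (p has_vector_derivative Q t *v z t - (J *v p t) v* A t) (at t within {0..1})"
    using extremal_exists by blast
  define u where "u t = ctrl t (p t)" for t
  define \<gamma> where "\<gamma> t = J *v p t" for t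
  define \<rho> where "\<rho> t = Q t *v z t" for t
  have I\<gamma>: "I *v \<gamma> t = p t" for t
    using eps_pos by (simp add: \<gamma>_def I_eps_inverse)
  have zc: "continuous_on {0..1} z" and pc: "continuous_on {0..1} p"
    unfolding continuous_on_eq_continuous_within
    using z p has_vector_derivative_continuous by blast+
  have uc: "continuous_on {0..1} u"
    unfolding u_def by (intro ctrl_cont pc continuous_intros) auto
  define z' where "z' t = J *v (A t *v z t) + b t *v u t" for t
  define \<gamma>' where "\<gamma>' t = J *v (Q t *v z t - \<gamma> t v* A t)" for t
  have z'c: "continuous_on {0..1} z'"
    unfolding z'_def by (intro continuous_intros A_cont b_cont zc uc)
  have zd: "(z has_vector_derivative z' t) (at t within {0..1})" if "t \<in> {0..1}" for t
    using z[OF that] by (simp add: z'_def u_def)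
  have \<gamma>d: "(\<gamma> has_vector_derivative \<gamma>' t) (at t within {0..1})" if "t \<in> {0..1}" for t
    using bounded_linear.has_vector_derivative[OF matrix_vector_mul_bounded_linear p[OF that], of J]
    by (simp add: \<gamma>_def[abs_def] \<gamma>'_def)
  have \<gamma>c: "continuous_on {0..1} \<gamma>"
    unfolding \<gamma>_def by (intro continuous_intros pc)
  have ddt: "ddt f t = f' t" if "\<And>t. t \<in> {0..1} \<Longrightarrow> (f has_vector_derivative f' t) (at t within {0..1})"
    "t \<in> {0..1}" for f f' :: "real \<Rightarrow> real^('m + 'n)" and t
    unfolding ddt_def using that by (intro vector_derivative_within_closed_interval) auto
  have ddtz: "ddt z t = z' t" and ddt\<gamma>: "ddt \<gamma> t = \<gamma>' t" if "t \<in> {0..1}" for t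
    using ddt[of z z'] ddt[of \<gamma> \<gamma>'] zd \<gamma>d that by blast+
  have primal: "primal_feasible S \<epsilon> u z"
    unfolding primal_feasible_def
  proof (intro conjI)
    have "u \<in> L2"
      unfolding L2_def using uc
      by (auto intro!: continuous_imp_measurable_on_sets_lebesgue continuous_imp_integrable_real continuous_intros)
    moreover have "AE t in leb01. \<forall>j. alpha S t $ j \<le> u t $ j \<and> u t $ j \<le> beta S t $ j"
      using clip_bounds[OF alpha_le_beta] by (intro AE_I2) (simp add: u_def ctrl_def)
    ultimately show "u \<in> controls S" by (simp add: controls_def)
    show "z \<in> W12" by (rule continuously_differentiable_in_W12[OF zd z'c])
    show "AE t in leb01. I *v ddt z t = A t *v z t + (I ** b t) *v u t"
      using eps_pos
      by (intro AE_I2) (simp add: ddtz z'_def matrix_vector_right_distrib I_eps_inverse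
          flip: matrix_vector_mul_assoc)
  qed (rule z0)
  have dual: "dual_feasible S \<epsilon> \<gamma> \<rho>"
    unfolding dual_feasible_def
  proof (intro conjI)
    show "\<gamma> \<in> W12"
      by (rule continuously_differentiable_in_W12[OF \<gamma>d])
        (auto simp: \<gamma>'_def[abs_def] intro!: continuous_intros Q_cont A_cont zc \<gamma>c)
    obtain Q' where Q': "continuous_on {0..1} Q'"
      "\<And>t. t \<in> {0..1} \<Longrightarrow> (Q has_vector_derivative Q' t) (at t within {0..1})"
      using smooth01_continuously_differentiable[OF Q_smooth] by blast
    show "\<rho> \<in> W12"
    proof (rule continuously_differentiable_in_W12)
      show "(\<rho> has_vector_derivative (Q t *v z' t + Q' t *v z t)) (at t within {0..1})" if "t \<in> {0..1}" for t
        unfolding \<rho>_def[abs_def]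
        by (rule bounded_bilinear.has_vector_derivative[OF bounded_bilinear_matrix_vector_mult Q'(2)[OF that] zd[OF that]])
      show "continuous_on {0..1} (\<lambda>t. Q t *v z' t + Q' t *v z t)"
        by (intro continuous_intros Q_cont Q'(1) z'c zc)
    qed
    show "AE t in leb01. I *v ddt \<gamma> t = - (transpose (A t) *v \<gamma> t) + \<rho> t"
      using eps_pos by (intro AE_I2) (simp add: ddt\<gamma> \<gamma>'_def \<rho>_def I_eps_inverse)
  qed
  \<comment> \<open>The control defect vanishes because \<open>u\<close> is exactly the maximiser in
    \<open>theta_eq\<close>; the state defect is the equality case at
    \<open>\<rho> = Q z\<close>.\<close>
  have "state_gap z \<rho> t + control_gap u \<gamma> t = 0" if t: "t \<in> {0..1}" for t
    using conjugate_quadratic_eq[OF Q(2)[OF t], of "z t"]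
    by (simp add: state_gap_def \<rho>_def control_gap_def theta_eq[OF t] I\<gamma> u_def)
  then have "(\<integral>t. state_gap z \<rho> t + control_gap u \<gamma> t \<partial>leb01) = 0"
    by (intro integral_eq_zero_AE AE_I2) simp
  moreover have "terminal_gap (z 1) (I *v \<gamma> 1) = 0"
    using conjugate_quadratic_eq[OF pi(2), of "- z 1"] p1
    by (simp add: terminal_gap_def I\<gamma> vec.neg)
  ultimately have "J_primal S \<epsilon> u z = J_dual S \<epsilon> \<gamma> \<rho>"
    using duality_gap[OF primal dual] by simp
  then show ?thesis using that primal dual by blast
qed

text \<open>Equal objectives sandwich all others by weak duality, so both points are optimal.
  Existence of optima is stated together with the equality because the values are definite
  descriptions; antisymmetry shows that each description has exactly one solution.\<close>

lemma values_equal: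
  "(\<exists>u z. primal_optimal S \<epsilon> u z) \<and> (\<exists>\<gamma> \<rho>. dual_optimal S \<epsilon> \<gamma> \<rho>) \<and> V_primal S \<epsilon> = V_dual S \<epsilon>"
proof -
  obtain u z \<gamma> \<rho> where f: "primal_feasible S \<epsilon> u z" "dual_feasible S \<epsilon> \<gamma> \<rho>"
    and eq: "J_primal S \<epsilon> u z = J_dual S \<epsilon> \<gamma> \<rho>"
    using strong_duality by blast
  have p: "primal_optimal S \<epsilon> u z"
    unfolding primal_optimal_def eq using weak_duality[OF _ f(2)] f(1) by blast
  have d: "dual_optimal S \<epsilon> \<gamma> \<rho>"
    unfolding dual_optimal_def eq[symmetric] using weak_duality[OF f(1)] f(2) by blast
  have "V_primal S \<epsilon> = J_primal S \<epsilon> u z"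
    unfolding V_primal_def using p
    by (intro the_equality) (auto simp: primal_optimal_def intro: antisym)
  moreover have "V_dual S \<epsilon> = J_dual S \<epsilon> \<gamma> \<rho>"
    unfolding V_dual_def using d
    by (intro the_equality) (auto simp: dual_optimal_def intro: antisym)
  ultimately show ?thesis using p d eq by auto
qed

end

theorem theorem1:
  fixes S :: "('m::finite, 'n::finite, 'k::finite) lq_data" and eps_star :: real
  assumes eps_star_pos: "eps_star > 0"
    and bounds_smooth: "smooth01 (alpha S)" "smooth01 (beta S)"
    and R_diag: "\<forall>t\<in>{0..1}. \<forall>\<epsilon>\<in>{0<..eps_star}. diagonal (Rmat S t \<epsilon>) \<and> pos_def (Rmat S t \<epsilon>)"
    and Q_pd: "\<forall>t\<in>{0..1}. \<forall>\<epsilon>\<in>{0<..eps_star}.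
      transpose (Qmat S t \<epsilon>) = Qmat S t \<epsilon> \<and> pos_def (Qmat S t \<epsilon>)"
    and pi_pd: "\<forall>\<epsilon>\<in>{0<..eps_star}. transpose (pimat S \<epsilon>) = pimat S \<epsilon> \<and> pos_def (pimat S \<epsilon>)"
    and A22_nd: "\<forall>t\<in>{0..1}. \<forall>\<epsilon>\<in>{0..eps_star}. neg_def (A22 S t \<epsilon>)"
    and smooth_t: "\<forall>\<epsilon>\<in>{0..eps_star}.
      smooth01 (\<lambda>t. Qmat S t \<epsilon>) \<and> smooth01 (\<lambda>t. Rmat S t \<epsilon>) \<and>
      smooth01 (\<lambda>t. A11 S t \<epsilon>) \<and> smooth01 (\<lambda>t. A12 S t \<epsilon>) \<and>
      smooth01 (\<lambda>t. A21 S t \<epsilon>) \<and> smooth01 (\<lambda>t. A22 S t \<epsilon>) \<and>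
      smooth01 (\<lambda>t. b1 S t \<epsilon>) \<and> smooth01 (\<lambda>t. b2 S t \<epsilon>)"
    and series_eps: "\<forall>t\<in>{0..1}.
      has_power_series_on {0..eps_star} (\<lambda>\<epsilon>. Qmat S t \<epsilon>) \<and>
      has_power_series_on {0..eps_star} (\<lambda>\<epsilon>. Rmat S t \<epsilon>) \<and>
      has_power_series_on {0..eps_star} (\<lambda>\<epsilon>. A11 S t \<epsilon>) \<and>
      has_power_series_on {0..eps_star} (\<lambda>\<epsilon>. A12 S t \<epsilon>) \<and>
      has_power_series_on {0..eps_star} (\<lambda>\<epsilon>. A21 S t \<epsilon>) \<and>
      has_power_series_on {0..eps_star} (\<lambda>\<epsilon>. A22 S t \<epsilon>) \<and>
      has_power_series_on {0..eps_star} (\<lambda>\<epsilon>. b1 S t \<epsilon>) \<and>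
      has_power_series_on {0..eps_star} (\<lambda>\<epsilon>. b2 S t \<epsilon>)"
    and series_pi: "has_power_series_on {0..eps_star} (pimat S)"
    and feasible: "\<forall>\<epsilon>\<in>{0<..eps_star}. \<exists>u z. primal_feasible S \<epsilon> u z"
  shows "\<forall>\<epsilon>\<in>{0<..eps_star}.
    (\<exists>u z. primal_optimal S \<epsilon> u z) \<and> (\<exists>\<gamma> \<rho>. dual_optimal S \<epsilon> \<gamma> \<rho>) \<and>
    V_primal S \<epsilon> = V_dual S \<epsilon>"
proof
  fix \<epsilon> assume \<epsilon>: "\<epsilon> \<in> {0<..eps_star}"
  then have "\<epsilon> \<in> {0..eps_star}" by auto
  note smooth = bspec[OF smooth_t this]
  interpret lq_problem S \<epsilon>
  proof
    show "continuous_on {0..1} (\<lambda>t. Amat S t \<epsilon>)"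
      unfolding Amat_def using smooth by (intro continuous_on_block_mat smooth01_imp_continuous_on) auto
    show "continuous_on {0..1} (\<lambda>t. bmat S t \<epsilon>)"
      unfolding bmat_def using smooth by (intro continuous_on_stack smooth01_imp_continuous_on) auto
  qed (use \<epsilon> smooth bounds_smooth R_diag Q_pd pi_pd feasible in \<open>auto intro: smooth01_imp_continuous_on\<close>)
  show "(\<exists>u z. primal_optimal S \<epsilon> u z) \<and> (\<exists>\<gamma> \<rho>. dual_optimal S \<epsilon> \<gamma> \<rho>) \<and> V_primal S \<epsilon> = V_dual S \<epsilon>"
    by (rule values_equal)
qed

end
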